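(* Fix a positive integer $q$ and an arbitrary $\epsilon>0$. Let $P_n$ be a random many-to-one school choice problem with $n$ schools of quota $q$ and $nq$ students. With probability tending to $1$ as $n\to\infty$, the envy digraph $G^{\mathrm{DA}(P_n)}$ has a strongly connected component containing at least $(1-\epsilon)nq$ students.
   Context: A random many-to-one school choice problem $P_n$ with quota $q$: a set $S$ of $n$ schools, each with quota $q$, and a set $I$ of $nq$ students; each student's strict preference over $S$ is a uniformly random linear order, each school's strict priority over $I$ is a uniformly random linear order, all mutually independent. $\mathrm{DA}(P_n)$ is the matching produced by student-proposing deferred acceptance: in each round every student not tentatively held applies to her most preferred school that has not yet rejected her; each school tentatively holds its $q$ highest-priority applicants (new and previously held) and rejects the rest; stop when a round has no new rejection. The envy digraph $G^{\mathrm{DA}(P_n)}$ has vertex set $I$ and a directed edge $(i,j)$ iff $i$ strictly prefers $\mathrm{DA}_j(P_n)$ to $\mathrm{DA}_i(P_n)$. A strongly connected component is a maximal set of vertices such that each ordered pair of them is joined by a directed path. *)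

theory Defs
  imports "HOL-Analysis.Analysis" "HOL-Combinatorics.Permutations" "HOL-Library.FuncSet"
begin

text \<open>Schools are 0..<n, students are 0..<n*q.
 A strict preference of a student is a permutation p of {..<n}: p k is the school she ranks
 at position k (position 0 = most preferred); so her rank of school s is inv p s.
 A strict priority of school s is a permutation of {..<n*q}: Q s k is the student at
 position k (position 0 = highest priority).\<close>

definition profiles :: "nat \<Rightarrow> nat \<Rightarrow> ((nat \<Rightarrow> nat \<Rightarrow> nat) \<times> (nat \<Rightarrow> nat \<Rightarrow> nat)) set" where
  "profiles n q =
     (PiE {..<n*q} (\<lambda>_. {p. p permutes {..<n}})) \<times> (PiE {..<n} (\<lambda>_. {p. p permutes {..<n*q}}))"

text \<open>A DA state r records, for each student, how many schools have rejected her so far;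
 her current (tentative) school is P i (r i). One round: every student applies to / stays at
 her current school; each school keeps its q highest-priority applicants and rejects the rest.\<close>

definition da_rejected :: "nat \<Rightarrow> nat \<Rightarrow> (nat \<Rightarrow> nat \<Rightarrow> nat) \<Rightarrow> (nat \<Rightarrow> nat \<Rightarrow> nat)
    \<Rightarrow> (nat \<Rightarrow> nat) \<Rightarrow> nat \<Rightarrow> bool" where
  "da_rejected n q P Q r i \<longleftrightarrow> i < n*q \<and> r i < n \<and>
     q \<le> card {j. j < n*q \<and> r j < n \<and> P j (r j) = P i (r i) \<and>
                 inv (Q (P i (r i))) j < inv (Q (P i (r i))) i}"

definition da_step :: "nat \<Rightarrow> nat \<Rightarrow> (nat \<Rightarrow> nat \<Rightarrow> nat) \<Rightarrow> (nat \<Rightarrow> nat \<Rightarrow> nat)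
    \<Rightarrow> (nat \<Rightarrow> nat) \<Rightarrow> (nat \<Rightarrow> nat)" where
  "da_step n q P Q r = (\<lambda>i. if da_rejected n q P Q r i then Suc (r i) else r i)"

text \<open>Run rounds from the initial state until a round has no new rejection.\<close>
definition da_final :: "nat \<Rightarrow> nat \<Rightarrow> (nat \<Rightarrow> nat \<Rightarrow> nat) \<Rightarrow> (nat \<Rightarrow> nat \<Rightarrow> nat) \<Rightarrow> (nat \<Rightarrow> nat)" where
  "da_final n q P Q =
     (let k = (LEAST k. \<forall>i. \<not> da_rejected n q P Q ((da_step n q P Q ^^ k) (\<lambda>_. 0)) i)
      in (da_step n q P Q ^^ k) (\<lambda>_. 0))"

text \<open>The DA matching: school assigned to student i.\<close>
definition DA :: "nat \<Rightarrow> nat \<Rightarrow> (nat \<Rightarrow> nat \<Rightarrow> nat) \<Rightarrow> (nat \<Rightarrow> nat \<Rightarrow> nat) \<Rightarrow> nat \<Rightarrow> nat" where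
  "DA n q P Q i = P i (da_final n q P Q i)"

text \<open>Envy digraph: edge (i,j) iff i strictly prefers DA j to DA i.\<close>
definition envy_edges :: "nat \<Rightarrow> nat \<Rightarrow> (nat \<Rightarrow> nat \<Rightarrow> nat) \<Rightarrow> (nat \<Rightarrow> nat \<Rightarrow> nat) \<Rightarrow> (nat \<times> nat) set" where
  "envy_edges n q P Q = {(i, j). i < n*q \<and> j < n*q \<and>
      inv (P i) (DA n q P Q j) < inv (P i) (DA n q P Q i)}"

text \<open>Strongly connected component of digraph (V, E).\<close>
definition strongly_connected_set :: "'a set \<Rightarrow> ('a \<times> 'a) set \<Rightarrow> 'a set \<Rightarrow> bool" where
  "strongly_connected_set V E C \<longleftrightarrow> C \<subseteq> V \<and> (\<forall>x\<in>C. \<forall>y\<in>C. (x, y) \<in> (E \<inter> V \<times> V)\<^sup>*)"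

definition is_scc :: "'a set \<Rightarrow> ('a \<times> 'a) set \<Rightarrow> 'a set \<Rightarrow> bool" where
  "is_scc V E C \<longleftrightarrow> C \<noteq> {} \<and> strongly_connected_set V E C \<and>
     (\<forall>D. C \<subseteq> D \<and> strongly_connected_set V E D \<longrightarrow> D = C)"

end

theory Submission
  imports Defs "HOL-Probability.Probability_Mass_Function" "HOL-Real_Asymp.Real_Asymp"
begin

text \<open>
  If there is no large strongly connected component, some set of students that is closed under envy
  contains neither almost none nor almost all of them. No member of the set has been rejected by a
  school of the set \<open>T\<close> of schools attended outside it. If all but few students have been rejected at
  least \<open>k\<close> times, this makes linearly many students have their first \<open>k\<close> choices outside the linearly
  large set \<open>T\<close>; for \<open>k\<close> large a union bound over all pairs of sets shows that this is exponentially
  unlikely.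

  It remains to see that, for fixed \<open>k\<close>, few students are rejected less than \<open>k\<close> times. Cutting all
  preference lists after a large constant number \<open>K\<close> of entries only removes rejections. For a given
  vector \<open>r\<close> of rejection counts, let \<open>M\<close> be the number of applications and \<open>A\<close> the number of
  accepted ones. Truncation makes the choices independent up to a constant factor, and a school with
  \<open>e\<close> applicants accepts a uniformly random set of \<open>min q e\<close> of them; by exchangeability the
  probability of \<open>r\<close> is at most a constant times \<open>1 / (M choose A)\<close> times the probability that \<open>M\<close>
  balls in \<open>n\<close> bins of capacity \<open>q\<close> leave exactly \<open>A\<close> balls. Up to a factor \<open>M + 1\<close>,
  \<open>1 / (M choose A)\<close> is the weight of \<open>r\<close> under independent geometric variables with success rate
  \<open>A / M\<close>, truncated at \<open>K\<close>. If \<open>M \<ge> \<mu> n\<close>, the rate is at most \<open>q / \<mu>\<close> and few variables are below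
  \<open>k\<close>. If \<open>M < \<mu> n\<close>, at most \<open>\<mu> n / K\<close> students have used up their lists, so almost no bin is
  empty, which is exponentially unlikely.
\<close>

section \<open>Deferred acceptance with capped preference lists\<close>

text \<open>A state \<open>r\<close> counts the rejections of each student. Every preference list is cut off after its
  first \<open>c\<close> entries, so \<open>r i = c\<close> means that student \<open>i\<close> has dropped out.\<close>

locale school_choice =
  fixes I :: "'i set" and quota :: "'s \<Rightarrow> nat" and P :: "'i \<Rightarrow> nat \<Rightarrow> 's"
    and rank :: "'s \<Rightarrow> 'i \<Rightarrow> 'r::linorder"
begin

definition holders :: "nat \<Rightarrow> ('i \<Rightarrow> nat) \<Rightarrow> 's \<Rightarrow> 'i set" where
  "holders c r s = {i \<in> I. r i < c \<and> P i (r i) = s}"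

definition better_holders :: "nat \<Rightarrow> ('i \<Rightarrow> nat) \<Rightarrow> 's \<Rightarrow> 'i \<Rightarrow> 'i set" where
  "better_holders c r s i = {j \<in> holders c r s. rank s j < rank s i}"

definition rejected :: "nat \<Rightarrow> ('i \<Rightarrow> nat) \<Rightarrow> 'i \<Rightarrow> bool" where
  "rejected c r i \<longleftrightarrow> i \<in> I \<and> r i < c \<and> quota (P i (r i)) \<le> card (better_holders c r (P i (r i)) i)"

definition step :: "nat \<Rightarrow> ('i \<Rightarrow> nat) \<Rightarrow> 'i \<Rightarrow> nat" where
  "step c r i = (if rejected c r i then Suc (r i) else r i)"

definition state :: "nat \<Rightarrow> nat \<Rightarrow> 'i \<Rightarrow> nat" where
  "state c m = (step c ^^ m) (\<lambda>_. 0)"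

definition final :: "nat \<Rightarrow> 'i \<Rightarrow> nat" where
  "final c = state c (LEAST m. \<forall>i. \<not> rejected c (state c m) i)"

lemma state_0 [simp]: "state c 0 = (\<lambda>_. 0)"
  by (simp add: state_def)

lemma state_Suc [simp]: "state c (Suc m) = step c (state c m)"
  by (simp add: state_def)

lemma state_le: "state c m i \<le> c"
  by (induction m) (auto simp: step_def rejected_def)

lemma final_eq_state: "\<exists>m. final c = state c m"
  unfolding final_def by blast

lemma final_le: "final c i \<le> c"
  using final_eq_state state_le by metis

end

locale strict_school_choice = school_choice I quota P rank
  for I :: "'i set" and quota :: "'s \<Rightarrow> nat" and P :: "'i \<Rightarrow> nat \<Rightarrow> 's"
    and rank :: "'s \<Rightarrow> 'i \<Rightarrow> 'r::linorder" +
  fixes L :: nat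
  assumes finite_students: "finite I"
    and inj_rank: "\<lbrakk>i \<in> I; j < L\<rbrakk> \<Longrightarrow> inj_on (rank (P i j)) I"

lemma card_few_below_ge:
  fixes f :: "'a \<Rightarrow> 'b::linorder"
  assumes "finite X" and "q \<le> card X"
  shows "q \<le> card {y \<in> X. card {z \<in> X. f z < f y} < q}"
proof (rule ccontr)
  define low where "low = {y \<in> X. card {z \<in> X. f z < f y} < q}"
  assume "\<not> ?thesis"
  then have few: "card low < q" by (simp add: low_def)
  have "low \<subseteq> X" by (auto simp: low_def)
  with few assms have "X - low \<noteq> {}" by auto
  with assms(1) obtain y where y: "y \<in> X - low" "\<And>z. z \<in> X - low \<Longrightarrow> f y \<le> f z"
    using obtains_MIN[of "X - low" f] by (metis Min_le finite_Diff finite_imageI imageI)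
  then have "{z \<in> X. f z < f y} \<subseteq> low" by force
  then have "card {z \<in> X. f z < f y} \<le> card low"
    using assms(1) \<open>low \<subseteq> X\<close> by (intro card_mono) (auto intro: finite_subset)
  with few y(1) show False by (simp add: low_def)
qed

context strict_school_choice
begin

lemma finite_holders [simp]: "finite (holders c r s)"
  using finite_students by (simp add: holders_def)

lemma finite_better_holders [simp]: "finite (better_holders c r s i)"
  by (simp add: better_holders_def)

lemma better_holders_full_step:
  assumes "quota s \<le> card (better_holders c r s i)"
  shows "quota s \<le> card (better_holders c (step c r) s i)"
proof -
  let ?X = "better_holders c r s i"
  let ?best = "{y \<in> ?X. card {z \<in> ?X. rank s z < rank s y} < quota s}"
  have "y \<in> better_holders c (step c r) s i" if y: "y \<in> ?best" for y
  proof -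
    have "{z \<in> ?X. rank s z < rank s y} = better_holders c r s y"
      using y by (auto simp: better_holders_def)
    with y have "\<not> rejected c r y"
      by (auto simp: rejected_def better_holders_def holders_def)
    with y show ?thesis by (simp add: better_holders_def holders_def step_def)
  qed
  then have "card ?best \<le> card (better_holders c (step c r) s i)"
    by (intro card_mono) auto
  moreover have "quota s \<le> card ?best"
    using assms by (intro card_few_below_ge) simp_all
  ultimately show ?thesis by linarith
qed

lemma better_holders_full_state:
  assumes "i \<in> I" and "j < state c m i"
  shows "quota (P i j) \<le> card (better_holders c (state c m) (P i j) i)"
  using assms(2)
proof (induction m)
  case (Suc m)
  have "quota (P i j) \<le> card (better_holders c (state c m) (P i j) i)"
  proof (cases "j < state c m i")
    case False
    with Suc.prems have "rejected c (state c m) i" "j = state c m i"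
      by (auto simp: step_def split: if_splits)
    then show ?thesis by (simp add: rejected_def)
  qed (rule Suc.IH)
  then show ?case by (simp add: better_holders_full_step)
qed simp

lemma ex_stable_state: "\<exists>m. \<forall>i. \<not> rejected c (state c m) i"
proof (rule ccontr)
  assume unstable: "\<not> ?thesis"
  have "m \<le> (\<Sum>i\<in>I. state c m i)" for m
  proof (induction m)
    case (Suc m)
    obtain i where "rejected c (state c m) i" using unstable by blast
    then have "(\<Sum>i\<in>I. state c m i) < (\<Sum>i\<in>I. state c (Suc m) i)"
      by (intro sum_strict_mono_ex1 finite_students) (auto simp: step_def rejected_def)
    with Suc.IH show ?case by linarith
  qed simp
  moreover have "(\<Sum>i\<in>I. state c m i) \<le> card I * c" for m
    using sum_bounded_above[of I "state c m" c] state_le by simp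
  ultimately have "Suc (card I * c) \<le> card I * c" by (meson order.trans)
  then show False by simp
qed

lemma not_rejected_final: "\<not> rejected c (final c) i"
  using LeastI_ex[OF ex_stable_state] unfolding final_def by blast

lemma card_holders_final_le:
  assumes "c \<le> L"
  shows "card (holders c (final c) s) \<le> quota s"
proof (rule ccontr)
  let ?X = "holders c (final c) s"
  assume overfull: "\<not> card ?X \<le> quota s"
  then have "?X \<noteq> {}" by auto
  then obtain w where w: "w \<in> ?X" "\<And>y. y \<in> ?X \<Longrightarrow> rank s y \<le> rank s w"
    using obtains_MAX[of ?X "rank s"] by (metis Max_ge finite_holders finite_imageI imageI)
  have "inj_on (rank s) I"
    using inj_rank[of w "final c w"] w(1) assms by (auto simp: holders_def)
  then have "?X - {w} \<subseteq> better_holders c (final c) s w"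
    using w by (fastforce simp: better_holders_def holders_def dest: inj_onD)
  then have "card (?X - {w}) \<le> card (better_holders c (final c) s w)"
    by (intro card_mono) auto
  with overfull w(1) have "rejected c (final c) w"
    by (simp add: rejected_def holders_def)
  then show False using not_rejected_final by blast
qed

lemma
  assumes "c \<le> L" and "i \<in> I" and "j < final c i"
  shows card_rejecter_holders: "card (holders c (final c) (P i j)) = quota (P i j)"
    and rejecter_holders_better:
      "holders c (final c) (P i j) = better_holders c (final c) (P i j) i"
proof -
  let ?all = "holders c (final c) (P i j)" and ?better = "better_holders c (final c) (P i j) i"
  have "quota (P i j) \<le> card ?better"
    using better_holders_full_state assms(2,3) final_eq_state[of c] by metis
  moreover have "?better \<subseteq> ?all" by (auto simp: better_holders_def)
  moreover from this have "card ?better \<le> card ?all" by (intro card_mono) auto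
  moreover have "card ?all \<le> quota (P i j)" using assms(1) by (rule card_holders_final_le)
  ultimately show "card ?all = quota (P i j)" "?all = ?better"
    using card_subset_eq[of ?all ?better] by auto
qed

lemma state_le_final_longer_list:
  assumes "c \<le> c'" and "c' \<le> L"
  shows "state c m i \<le> final c' i"
proof (induction m arbitrary: i)
  case (Suc m)
  let ?r = "state c m" and ?F = "final c'"
  show ?case
  proof (cases "rejected c ?r i \<and> ?r i = ?F i")
    case False
    then show ?thesis using Suc.IH[of i] by (auto simp: step_def)
  next
    case True
    define s where "s = P i (?r i)"
    have i: "i \<in> I" "?r i < c" "quota s \<le> card (better_holders c ?r s i)"
      using True by (auto simp: rejected_def s_def)
    have "i \<in> holders c' ?F s" using i True assms(1) by (simp add: holders_def s_def)
    have "better_holders c ?r s i \<subseteq> better_holders c' ?F s i"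
    proof (rule ccontr)
      assume "\<not> ?thesis"
      then obtain l where l: "l \<in> better_holders c ?r s i" "l \<notin> better_holders c' ?F s i" by blast
      then have "?r l \<noteq> ?F l" using assms(1) by (auto simp: better_holders_def holders_def)
      then have "?r l < ?F l" using Suc.IH[of l] by simp
      then have "rank s i < rank s l"
        using rejecter_holders_better[OF assms(2), of l "?r l"] l(1) \<open>i \<in> holders c' ?F s\<close>
        by (auto simp: better_holders_def holders_def)
      then show False using l(1) by (auto simp: better_holders_def)
    qed
    then have "card (better_holders c ?r s i) \<le> card (better_holders c' ?F s i)"
      by (intro card_mono) auto
    then have "rejected c' ?F i" using i True assms(1) by (simp add: rejected_def s_def)
    then show ?thesis using not_rejected_final by blast
  qed
qed simp

lemma final_mono:
  assumes "c \<le> c'" and "c' \<le> L"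
  shows "final c i \<le> final c' i"
  using state_le_final_longer_list[OF assms] final_eq_state[of c] by metis

end

section \<open>Large strongly connected components\<close>

lemma strongly_connected_subset_scc:
  assumes "strongly_connected_set V E C" and "C \<noteq> {}"
  obtains D where "is_scc V E D" and "C \<subseteq> D"
proof -
  let ?R = "(E \<inter> V \<times> V)\<^sup>*"
  obtain c where "c \<in> C" using assms(2) by blast
  let ?D = "{y \<in> V. (c, y) \<in> ?R \<and> (y, c) \<in> ?R}"
  have "C \<subseteq> ?D" using assms(1) \<open>c \<in> C\<close> by (auto simp: strongly_connected_set_def)
  moreover have "strongly_connected_set V E ?D"
    unfolding strongly_connected_set_def by (auto intro: rtrancl_trans)
  moreover have "X \<subseteq> ?D" if "strongly_connected_set V E X" "?D \<subseteq> X" for X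
    using that \<open>c \<in> C\<close> \<open>C \<subseteq> ?D\<close> unfolding strongly_connected_set_def by blast
  ultimately have "is_scc V E ?D" using \<open>c \<in> C\<close> unfolding is_scc_def by blast
  then show thesis using \<open>C \<subseteq> ?D\<close> by (rule that)
qed

definition out_closed :: "'a set \<Rightarrow> ('a \<times> 'a) set \<Rightarrow> 'a set \<Rightarrow> bool" where
  "out_closed V E A \<longleftrightarrow> A \<subseteq> V \<and> E `` A \<inter> V \<subseteq> A"

lemma out_closed_Un: "out_closed V E A \<Longrightarrow> out_closed V E B \<Longrightarrow> out_closed V E (A \<union> B)"
  by (auto simp: out_closed_def)

lemma out_closed_reachable:
  assumes "x \<in> V"
  shows "out_closed V E ((E \<inter> V \<times> V)\<^sup>* `` {x})"
proof -
  have "y \<in> V" if "(x, y) \<in> (E \<inter> V \<times> V)\<^sup>*" for y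
    using that assms by (induction rule: rtrancl_induct) auto
  then show ?thesis by (auto simp: out_closed_def intro: rtrancl_into_rtrancl)
qed

lemma strongly_connected_minimal_reachable:
  fixes V :: "'a set" and E :: "('a \<times> 'a) set"
  defines "R \<equiv> \<lambda>x. (E \<inter> V \<times> V)\<^sup>* `` {x}"
  assumes "finite V" and x: "x \<in> V - A" "\<And>y. y \<in> V - A \<Longrightarrow> card (R x) \<le> card (R y)"
  shows "strongly_connected_set V E (R x - A)"
  unfolding strongly_connected_set_def
proof (intro conjI ballI)
  have "out_closed V E (R x)" unfolding R_def using x(1) by (intro out_closed_reachable) simp
  then show sub: "R x - A \<subseteq> V" by (auto simp: out_closed_def)
  have "finite (R x)"
    using \<open>out_closed V E (R x)\<close> \<open>finite V\<close> finite_subset by (auto simp: out_closed_def)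
  fix y z assume y: "y \<in> R x - A" and z: "z \<in> R x - A"
  have "R y \<subseteq> R x" using y by (auto simp: R_def intro: rtrancl_trans)
  moreover have "card (R x) \<le> card (R y)" using x(2) y sub by blast
  ultimately have "R y = R x" using \<open>finite (R x)\<close> by (intro card_seteq)
  then show "(y, z) \<in> (E \<inter> V \<times> V)\<^sup>*" using z by (auto simp: R_def)
qed

text \<open>Adding the strongly connected components one at a time, sinks first, gives a chain of closed
  sets; the component at which the chain jumps over the forbidden range is large.\<close>

lemma large_scc_if_no_balanced_out_closed:
  fixes a :: real
  assumes "finite V" and "0 < a" and "a \<le> card V"
    and unbalanced: "\<And>A. out_closed V E A \<Longrightarrow> a \<le> card A \<Longrightarrow> card V - a < card A"
  obtains C where "is_scc V E C" and "card V - 2 * a \<le> card C"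
proof -
  let ?R = "\<lambda>x. (E \<inter> V \<times> V)\<^sup>* `` {x}"
  let ?small = "{A. out_closed V E A \<and> real (card A) < a}"
  have "finite ?small"
    by (rule finite_subset[of _ "Pow V"]) (use assms(1) in \<open>auto simp: out_closed_def\<close>)
  moreover have "{} \<in> ?small" using assms(2) by (simp add: out_closed_def)
  ultimately obtain A where "A \<in> ?small" and A_max: "\<And>B. \<lbrakk>B \<in> ?small; A \<subseteq> B\<rbrakk> \<Longrightarrow> A = B"
    using finite_has_maximal[of ?small] by blast
  then have A: "out_closed V E A" "real (card A) < a" by simp_all
  then have "finite A" using assms(1) finite_subset by (auto simp: out_closed_def)
  then have "V - A \<noteq> {}" using A(2) assms(3) card_mono[of A V] by force
  then obtain x where x: "x \<in> V - A" "\<And>y. y \<in> V - A \<Longrightarrow> card (?R x) \<le> card (?R y)"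
    using ex_has_least_nat[of "\<lambda>x. x \<in> V - A" _ "\<lambda>x. card (?R x)"] by blast
  have "out_closed V E (A \<union> ?R x)"
    using x(1) A(1) by (intro out_closed_Un out_closed_reachable) auto
  moreover have "A \<noteq> A \<union> ?R x" using x(1) by blast
  ultimately have "card V - a < card (A \<union> ?R x)"
    using unbalanced A_max[of "A \<union> ?R x"] by force
  also have "card (A \<union> ?R x) \<le> card A + card (?R x - A)"
    using card_Un_le[of A "?R x - A"] by simp
  finally have large: "card V - 2 * a < card (?R x - A)" using A(2) by simp
  have "?R x - A \<noteq> {}" using x(1) by blast
  with strongly_connected_minimal_reachable[OF assms(1) x]
  obtain C where C: "is_scc V E C" "?R x - A \<subseteq> C" by (rule strongly_connected_subset_scc)
  moreover have "finite C"
    using C(1) assms(1) finite_subset by (auto simp: is_scc_def strongly_connected_set_def)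
  ultimately have "card (?R x - A) \<le> card C" by (intro card_mono)
  with large C(1) that show thesis by force
qed

section \<open>Counting permutations\<close>

lemma card_permutations_prescribed_le:
  assumes "finite A" and "B \<subseteq> A"
  shows "card {p. p permutes A \<and> (\<forall>b\<in>B. p b = w b)} \<le> fact (card A - card B)"
proof (cases "{p. p permutes A \<and> (\<forall>b\<in>B. p b = w b)} = {}")
  case False
  then obtain p0 where p0: "p0 permutes A" "\<And>b. b \<in> B \<Longrightarrow> p0 b = w b" by blast
  have "card {p. p permutes A \<and> (\<forall>b\<in>B. p b = w b)} \<le> card {p. p permutes (A - B)}"
  proof (rule card_inj_on_le[where f = "\<lambda>p. inv p0 \<circ> p"])
    show "inj_on (\<lambda>p. inv p0 \<circ> p) {p. p permutes A \<and> (\<forall>b\<in>B. p b = w b)}"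
      by (rule inj_on_inverseI[where g = "\<lambda>p. p0 \<circ> p"])
        (simp add: o_assoc permutes_inv_o[OF p0(1)])
    show "(\<lambda>p. inv p0 \<circ> p) ` {p. p permutes A \<and> (\<forall>b\<in>B. p b = w b)} \<subseteq> {p. p permutes (A - B)}"
    proof clarify
      fix p assume p: "p permutes A" "\<forall>b\<in>B. p b = w b"
      show "inv p0 \<circ> p permutes (A - B)"
      proof (rule permutes_superset)
        show "inv p0 \<circ> p permutes A" using p(1) p0(1) by (intro permutes_compose permutes_inv)
        show "(inv p0 \<circ> p) b = b" if "b \<in> A - (A - B)" for b
          using p(2) p0(2) that permutes_inverses(2)[OF p0(1), of b] by simp
      qed
    qed
  qed (use assms(1) in \<open>simp add: finite_permutations\<close>)
  also have "\<dots> = fact (card A - card B)"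
    using assms by (simp add: card_permutations card_Diff_subset finite_subset)
  finally show ?thesis .
next
  case True
  then show ?thesis by (simp only: card.empty)
qed

lemma prod_diff_mult_fact: "k \<le> n \<Longrightarrow> (\<Prod>i<k. n - i) * fact (n - k) = (fact n :: nat)"
proof (induction k)
  case (Suc k)
  then have "fact (n - k) = (n - k) * (fact (n - Suc k) :: nat)"
    by (metis Suc_diff_Suc Suc_le_lessD fact_Suc of_nat_id)
  with Suc show ?case by (simp add: mult.assoc)
qed simp

lemma prod_diff_mult_power_le:
  fixes n u :: nat
  assumes "u \<le> n"
  shows "(\<Prod>i<k. u - i) * n ^ k \<le> (\<Prod>i<k. n - i) * u ^ k"
proof -
  have "(u - i) * n \<le> (n - i) * u" for i
    using assms by (simp only: diff_mult_distrib mult.commute[of n u] diff_le_mono2 mult_le_mono2)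
  then have "(\<Prod>i<k. (u - i) * n) \<le> (\<Prod>i<k. (n - i) * u)" by (intro prod_mono) auto
  then show ?thesis by (simp add: prod.distrib)
qed

lemma card_permutations_image_subset_le:
  assumes "finite A" and "J \<subseteq> A" and "U \<subseteq> A"
  shows "card {p. p permutes A \<and> p ` J \<subseteq> U} * card A ^ card J \<le> fact (card A) * card U ^ card J"
proof -
  let ?n = "card A" and ?k = "card J" and ?u = "card U"
  let ?W = "{w \<in> J \<rightarrow>\<^sub>E U. inj_on w J}"
  let ?S = "\<lambda>w. {p. p permutes A \<and> (\<forall>j\<in>J. p j = w j)}"
  have fin: "finite J" "finite U" using assms finite_subset by auto
  have "{p. p permutes A \<and> p ` J \<subseteq> U} \<subseteq> (\<Union>w\<in>?W. ?S w)"
  proof clarify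
    fix p assume p: "p permutes A" "p ` J \<subseteq> U"
    then have "restrict p J \<in> ?W" "p \<in> ?S (restrict p J)"
      using permutes_inj_on[OF p(1)] by (auto simp: inj_on_restrict_eq)
    then show "p \<in> (\<Union>w\<in>?W. ?S w)" by blast
  qed
  moreover have finW: "finite ?W"
    by (rule finite_subset[OF _ finite_PiE[of J "\<lambda>_. U"]]) (use fin in auto)
  moreover have "finite (?S w)" for w
    by (rule finite_subset[OF _ finite_permutations[OF assms(1)]]) auto
  ultimately have "card {p. p permutes A \<and> p ` J \<subseteq> U} \<le> card (\<Union>w\<in>?W. ?S w)"
    by (intro card_mono) auto
  also have "\<dots> \<le> (\<Sum>w\<in>?W. card (?S w))" using finW by (rule card_UN_le)
  also have "\<dots> \<le> (\<Sum>w\<in>?W. fact (?n - ?k))"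
    using assms by (intro sum_mono card_permutations_prescribed_le)
  also have "\<dots> = (\<Prod>i<?k. ?u - i) * fact (?n - ?k)"
    using card_inj_on_subset_funcset[OF fin order.refl] by (simp add: atLeast0LessThan)
  finally have "card {p. p permutes A \<and> p ` J \<subseteq> U} * ?n ^ ?k
      \<le> ((\<Prod>i<?k. ?u - i) * ?n ^ ?k) * fact (?n - ?k)"
    using mult_le_mono1 by (simp add: mult_ac)
  also have "\<dots> \<le> ((\<Prod>i<?k. ?n - i) * ?u ^ ?k) * fact (?n - ?k)"
    using assms by (intro mult_le_mono1 prod_diff_mult_power_le card_mono)
  also have "\<dots> = ((\<Prod>i<?k. ?n - i) * fact (?n - ?k)) * ?u ^ ?k" by (simp add: mult_ac)
  also have "\<dots> = fact ?n * ?u ^ ?k"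
    using assms card_mono by (subst prod_diff_mult_fact) auto
  finally show ?thesis .
qed

definition separating_permutations :: "'a::linorder set \<Rightarrow> 'a set \<Rightarrow> 'a set \<Rightarrow> ('a \<Rightarrow> 'a) set" where
  "separating_permutations U A B = {\<sigma>. \<sigma> permutes U \<and> (\<forall>a\<in>A. \<forall>b\<in>B. inv \<sigma> a < inv \<sigma> b)}"

lemma finite_separating_permutations [simp]: "finite U \<Longrightarrow> finite (separating_permutations U A B)"
  by (rule finite_subset[OF _ finite_permutations[of U]]) (auto simp: separating_permutations_def)

lemma card_separating_permutations_image:
  assumes "\<tau> permutes U"
  shows "card (separating_permutations U (\<tau> ` A) (\<tau> ` B)) = card (separating_permutations U A B)"
proof (rule bij_betw_same_card[OF bij_betw_byWitness[
      where f = "\<lambda>\<sigma>. inv \<tau> \<circ> \<sigma>" and f' = "\<lambda>\<sigma>. \<tau> \<circ> \<sigma>"]])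
  have inv_comp: "inv (\<pi> \<circ> \<sigma>) x = inv \<sigma> (inv \<pi> x)"
    if "\<pi> permutes U" "\<sigma> permutes U" for \<pi> \<sigma> :: "'a \<Rightarrow> 'a" and x
    using o_inv_distrib[OF permutes_bij permutes_bij] that by (metis comp_apply)
  show "(\<lambda>\<sigma>. inv \<tau> \<circ> \<sigma>) ` separating_permutations U (\<tau> ` A) (\<tau> ` B) \<subseteq> separating_permutations U A B"
    using assms by (auto simp: separating_permutations_def inv_comp permutes_inv
        permutes_inv_inv permutes_compose)
  show "(\<lambda>\<sigma>. \<tau> \<circ> \<sigma>) ` separating_permutations U A B \<subseteq> separating_permutations U (\<tau> ` A) (\<tau> ` B)"
    using assms
    by (auto simp: separating_permutations_def inv_comp permutes_inverses permutes_compose)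
qed (simp_all add: o_assoc permutes_inv_o[OF assms])

lemma separating_permutations_disjoint:
  assumes "finite E" and "S \<subseteq> E" and "S' \<subseteq> E" and "card S = card S'" and "S \<noteq> S'"
  shows "separating_permutations U S (E - S) \<inter> separating_permutations U S' (E - S') = {}"
proof -
  have "finite S" "finite S'" using assms finite_subset by auto
  then have "\<not> S \<subseteq> S'" "\<not> S' \<subseteq> S" using assms(4,5) by (metis card_subset_eq)+
  then obtain x y where "x \<in> S" "x \<notin> S'" "y \<in> S'" "y \<notin> S" by blast
  then have xy: "x \<in> S" "y \<in> E - S" "y \<in> S'" "x \<in> E - S'" using assms(2,3) by auto
  show ?thesis
  proof (rule equals0I)
    fix \<sigma> assume "\<sigma> \<in> separating_permutations U S (E - S) \<inter> separating_permutations U S' (E - S')"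
    then have "inv \<sigma> x < inv \<sigma> y" "inv \<sigma> y < inv \<sigma> x"
      using xy by (auto simp: separating_permutations_def)
    then show False by simp
  qed
qed

lemma ex_permutes_image_eq:
  assumes "finite E" and "A \<subseteq> E" and "S \<subseteq> E" and "card A = card S"
  obtains \<tau> where "\<tau> permutes E" and "\<tau> ` A = S"
proof -
  have fin: "finite A" "finite S" using assms finite_subset by auto
  obtain f where f: "bij_betw f A S" using finite_same_card_bij[OF fin assms(4)] by blast
  have "card (E - A) = card (E - S)" using assms fin by (simp add: card_Diff_subset)
  then obtain g where "bij_betw g (E - A) (E - S)"
    using assms(1) finite_same_card_bij[of "E - A" "E - S"] by blast
  with f have "bij_betw (\<lambda>x. if x \<in> A then f x else g x) (A \<union> (E - A)) (S \<union> (E - S))"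
    by (intro bij_betw_disjoint_Un) auto
  then have "restrict_id (\<lambda>x. if x \<in> A then f x else g x) E permutes E"
    using assms by (intro permutes_restrict_id) (simp add: Un_absorb1)
  moreover have "restrict_id (\<lambda>x. if x \<in> A then f x else g x) E ` A = S"
    using f assms(2) by (force simp: bij_betw_def)
  ultimately show thesis by (rule that)
qed

lemma card_separating_permutations_le:
  assumes "finite U" and "A \<subseteq> U" and "B \<subseteq> U" and "A \<inter> B = {}"
  shows "card (separating_permutations U A B) * ((card A + card B) choose card A) \<le> fact (card U)"
proof -
  let ?E = "A \<union> B"
  let ?C = "{S. S \<subseteq> ?E \<and> card S = card A}"
  let ?sep = "\<lambda>S. separating_permutations U S (?E - S)"
  have fin: "finite ?E" "finite A" "finite B" using assms by (auto intro: finite_subset)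
  have card_sep: "card (?sep S) = card (separating_permutations U A B)" if S: "S \<in> ?C" for S
  proof -
    obtain \<tau> where \<tau>: "\<tau> permutes ?E" "\<tau> ` A = S"
      using ex_permutes_image_eq[OF fin(1), of A S] S by auto
    have "\<tau> ` B = \<tau> ` (?E - A)" using assms(4) by (simp add: Un_Diff Int_commute Diff_triv)
    also have "\<dots> = ?E - S"
      unfolding image_set_diff[OF permutes_inj[OF \<tau>(1)]] permutes_image[OF \<tau>(1)] \<tau>(2) ..
    finally have "?sep S = separating_permutations U (\<tau> ` A) (\<tau> ` B)" using \<tau>(2) by simp
    also have "card \<dots> = card (separating_permutations U A B)"
      using permutes_subset[OF \<tau>(1), of U] assms by (intro card_separating_permutations_image) auto
    finally show ?thesis .
  qed
  have "card ?C = (card A + card B) choose card A"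
    using n_subsets[OF fin(1), of "card A"] fin assms(4) by (simp add: card_Un_disjoint)
  then have "card (separating_permutations U A B) * ((card A + card B) choose card A)
      = (\<Sum>S\<in>?C. card (?sep S))"
    using card_sep by (simp add: mult.commute)
  also have "\<dots> = card (\<Union>S\<in>?C. ?sep S)"
    using fin assms(1) separating_permutations_disjoint[OF fin(1)]
    by (intro card_UN_disjoint[symmetric] ballI impI) auto
  also have "\<dots> \<le> card {\<sigma>. \<sigma> permutes U}"
    by (intro card_mono finite_permutations assms) (auto simp: separating_permutations_def)
  also have "\<dots> = fact (card U)" using assms(1) by (simp add: card_permutations)
  finally show ?thesis .
qed

section \<open>Words with missed letters and quotas\<close>

lemma prod_add_ge_first_order:
  fixes a b :: "'a \<Rightarrow> 'b::linordered_idom"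
  assumes "finite S" and "\<And>s. s \<in> S \<Longrightarrow> 0 \<le> a s" and "\<And>s. s \<in> S \<Longrightarrow> 0 \<le> b s"
  shows "prod a S + (\<Sum>s\<in>S. b s * prod a (S - {s})) \<le> (\<Prod>s\<in>S. a s + b s)"
  using assms
proof (induction S rule: finite_induct)
  case (insert t S)
  let ?R = "\<Prod>s\<in>S. a s + b s"
  have "prod a (insert t S - {s}) = a t * prod a (S - {s})" if "s \<in> S" for s
    using that insert.hyps by (subst insert_Diff_if) auto
  then have "prod a (insert t S) + (\<Sum>s\<in>insert t S. b s * prod a (insert t S - {s}))
      = a t * (prod a S + (\<Sum>s\<in>S. b s * prod a (S - {s}))) + b t * prod a S"
    using insert.hyps by (simp add: sum_distrib_left algebra_simps)
  also have "\<dots> \<le> a t * ?R + b t * ?R"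
    using insert by (intro add_mono mult_left_mono insert.IH prod_mono) auto
  finally show ?case using insert.hyps by (simp add: distrib_right)
qed simp

lemma sum_prod_remove_le:
  fixes g :: "'a \<Rightarrow> real"
  assumes "finite S" and "S \<noteq> {}" and "\<And>s. s \<in> S \<Longrightarrow> g s \<in> {0..1}"
  shows "(\<Sum>s\<in>S. prod g (S - {s})) \<le> card S * (\<Prod>s\<in>S. g s + (1 - g s) / card S)"
proof -
  define n where "n = real (card S)"
  have "0 < n" using assms(1,2) by (simp add: n_def card_gt_0_iff)
  have summand: "(1 - g s) / n * prod g (S - {s}) = (prod g (S - {s}) - prod g S) / n"
    if "s \<in> S" for s
    using prod.remove[OF assms(1) that, of g] by (simp add: algebra_simps)
  have "(\<Sum>s\<in>S. (1 - g s) / n * prod g (S - {s})) = (\<Sum>s\<in>S. (prod g (S - {s}) - prod g S) / n)"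
    by (rule sum.cong[OF refl summand])
  also have "\<dots> = (\<Sum>s\<in>S. prod g (S - {s})) / n - prod g S"
    using \<open>0 < n\<close>
    by (simp add: sum_divide_distrib[symmetric] sum_subtractf diff_divide_distrib n_def)
  finally have "(\<Sum>s\<in>S. prod g (S - {s})) / n \<le> (\<Prod>s\<in>S. g s + (1 - g s) / n)"
    using prod_add_ge_first_order[of S g "\<lambda>s. (1 - g s) / n"] assms \<open>0 < n\<close> by simp
  then show ?thesis using \<open>0 < n\<close> by (simp add: n_def field_simps)
qed

lemma sum_PiE_insert:
  assumes "d \<notin> D"
  shows "(\<Sum>x\<in>insert d D \<rightarrow>\<^sub>E S. f x) = (\<Sum>s\<in>S. \<Sum>y\<in>D \<rightarrow>\<^sub>E S. f (y(d := s)))"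
  unfolding PiE_insert_eq sum.cartesian_product using assms
  by (subst sum.reindex[OF inj_combinator]) (simp_all only: o_def split_def not_False_eq_True)

text \<open>The events that single letters are missed are negatively correlated: for weights in the unit
  interval, the mean of the product is at most the product of the means.\<close>

lemma sum_prod_missed_le:
  fixes w :: "'s \<Rightarrow> real"
  assumes "finite D" and "finite S" and "S \<noteq> {}" and "\<And>s. s \<in> S \<Longrightarrow> w s \<in> {0..1}"
  shows "(\<Sum>x\<in>D \<rightarrow>\<^sub>E S. \<Prod>s\<in>S - x ` D. w s)
       \<le> real (card S) ^ card D * (\<Prod>s\<in>S. 1 - (1 - 1 / card S) ^ card D * (1 - w s))"
  using assms(1,4)
proof (induction D arbitrary: w rule: finite_induct)
  case (insert d D)
  define n where "n = real (card S)"
  define p where "p = (1 - 1 / n) ^ card D"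
  define g where "g s = 1 - p * (1 - w s)" for s
  have n: "1 \<le> n" using assms(2,3) by (simp add: n_def Suc_le_eq card_gt_0_iff)
  have p: "0 \<le> p" "p \<le> 1" using n by (auto simp: p_def intro!: power_le_one)
  have g: "0 \<le> g s" "g s \<le> 1" if "s \<in> S" for s
    using insert.prems[OF that] p mult_le_one[of p "1 - w s"] by (auto simp: g_def)
  have missed: "(\<Prod>u\<in>S - (y(d := s)) ` insert d D. w u) = (\<Prod>u\<in>S - y ` D. (w(s := 1)) u)" for s y
  proof -
    have "S - (y(d := s)) ` insert d D = (S - y ` D) - {s}"
      using insert.hyps by (auto simp: image_iff)
    then show ?thesis
      using assms(2) by (auto intro!: prod.mono_neutral_cong_left)
  qed
  have "(\<Sum>x\<in>insert d D \<rightarrow>\<^sub>E S. \<Prod>u\<in>S - x ` insert d D. w u)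
      = (\<Sum>s\<in>S. \<Sum>y\<in>D \<rightarrow>\<^sub>E S. \<Prod>u\<in>S - y ` D. (w(s := 1)) u)"
    by (simp only: sum_PiE_insert[OF insert.hyps(2)] missed)
  also have "\<dots> \<le> (\<Sum>s\<in>S. n ^ card D * (\<Prod>u\<in>S. 1 - p * (1 - (w(s := 1)) u)))"
    unfolding n_def p_def using insert.prems by (intro sum_mono insert.IH) auto
  also have "\<dots> = n ^ card D * (\<Sum>s\<in>S. prod g (S - {s}))"
    unfolding sum_distrib_left using assms(2)
    by (intro sum.cong refl arg_cong2[where f = "(*)"] prod.mono_neutral_cong_right)
      (auto simp: g_def)
  also have "\<dots> \<le> n ^ card D * (n * (\<Prod>s\<in>S. g s + (1 - g s) / n))"
    unfolding n_def using g assms(2,3) by (intro mult_left_mono sum_prod_remove_le) auto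
  also have "(\<Prod>s\<in>S. g s + (1 - g s) / n) = (\<Prod>s\<in>S. 1 - (1 - 1 / n) ^ card (insert d D) * (1 - w s))"
    using insert.hyps n by (intro prod.cong refl) (simp add: g_def p_def field_simps)
  finally show ?case
    using insert.hyps by (simp add: n_def mult_ac)
qed simp

lemma card_few_missed_le:
  fixes \<beta> :: real
  assumes "finite D" and "finite S" and "S \<noteq> {}"
  shows "card {x \<in> D \<rightarrow>\<^sub>E S. card (S - x ` D) \<le> \<beta> * card S}
       \<le> real (card S) ^ card D * (2 powr \<beta> * (1 - (1 - 1 / card S) ^ card D / 2)) ^ card S"
proof -
  let ?few = "{x \<in> D \<rightarrow>\<^sub>E S. card (S - x ` D) \<le> \<beta> * card S}"
  have finW: "finite (D \<rightarrow>\<^sub>E S)" using assms by (intro finite_PiE)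
  have "real (card ?few) = (\<Sum>x\<in>?few. 1)" by simp
  also have "\<dots> \<le> (\<Sum>x\<in>?few. 2 powr (\<beta> * card S) * (1 / 2) ^ card (S - x ` D))"
  proof (rule sum_mono)
    fix x assume "x \<in> ?few"
    then have "2 powr real (card (S - x ` D)) \<le> 2 powr (\<beta> * card S)" by simp
    then show "1 \<le> 2 powr (\<beta> * card S) * (1 / 2) ^ card (S - x ` D)"
      by (simp add: powr_realpow field_simps)
  qed
  also have "\<dots> \<le> 2 powr (\<beta> * card S) * (\<Sum>x\<in>D \<rightarrow>\<^sub>E S. (1 / 2) ^ card (S - x ` D))"
    unfolding sum_distrib_left using finW by (intro sum_mono2) auto
  also have "\<dots> \<le> 2 powr (\<beta> * card S)
      * (real (card S) ^ card D * (1 - (1 - 1 / card S) ^ card D / 2) ^ card S)"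
    using sum_prod_missed_le[OF assms, of "\<lambda>_. 1 / 2"] by (intro mult_left_mono) auto
  also have "2 powr (\<beta> * card S) = (2 powr \<beta>) ^ card S"
    by (simp add: powr_powr[symmetric] powr_realpow)
  finally show ?thesis by (simp only: power_mult_distrib mult_ac)
qed

definition fibre :: "'d set \<Rightarrow> ('d \<Rightarrow> 's) \<Rightarrow> 's \<Rightarrow> 'd set" where
  "fibre D x s = {d \<in> D. x d = s}"

text \<open>A word \<open>x\<close> sends every application in \<open>D\<close> to a school, and each school accepts as many of its
  applications as its quota permits. In \<open>quota_words\<close> the accepted applications are \<open>B\<close>; in
  \<open>filling_words\<close> only their number \<open>m\<close> is prescribed.\<close>

definition quota_words :: "'s set \<Rightarrow> ('s \<Rightarrow> nat) \<Rightarrow> 'd set \<Rightarrow> 'd set \<Rightarrow> ('d \<Rightarrow> 's) set" where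
  "quota_words S q D B =
     {x \<in> D \<rightarrow>\<^sub>E S. \<forall>s\<in>S. card (B \<inter> fibre D x s) = min (q s) (card (fibre D x s))}"

definition filling_words :: "'s set \<Rightarrow> ('s \<Rightarrow> nat) \<Rightarrow> 'd set \<Rightarrow> nat \<Rightarrow> ('d \<Rightarrow> 's) set" where
  "filling_words S q D m = {x \<in> D \<rightarrow>\<^sub>E S. (\<Sum>s\<in>S. min (q s) (card (fibre D x s))) = m}"

definition quota_weight :: "'s set \<Rightarrow> ('s \<Rightarrow> nat) \<Rightarrow> 'd set \<Rightarrow> ('d \<Rightarrow> 's) \<Rightarrow> real" where
  "quota_weight S q D x = (\<Prod>s\<in>S. 1 / (card (fibre D x s) choose min (q s) (card (fibre D x s))))"

lemma finite_fibre [simp]: "finite D \<Longrightarrow> finite (fibre D x s)"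
  by (simp add: fibre_def)

lemma finite_quota_words [simp]: "finite D \<Longrightarrow> finite S \<Longrightarrow> finite (quota_words S q D B)"
  by (rule finite_subset[OF _ finite_PiE[of D "\<lambda>_. S"]]) (auto simp: quota_words_def)

lemma finite_filling_words [simp]: "finite D \<Longrightarrow> finite S \<Longrightarrow> finite (filling_words S q D m)"
  by (rule finite_subset[OF _ finite_PiE[of D "\<lambda>_. S"]]) (auto simp: filling_words_def)

lemma quota_weight_nonneg: "0 \<le> quota_weight S q D x"
  unfolding quota_weight_def by (intro prod_nonneg) auto

lemma card_filling_words_le_power:
  assumes "finite D" and "finite S"
  shows "card (filling_words S q D m) \<le> card S ^ card D"
proof -
  have "card (filling_words S q D m) \<le> card (D \<rightarrow>\<^sub>E S)"
    using assms by (intro card_mono finite_PiE) (auto simp: filling_words_def)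
  then show ?thesis using assms by (simp add: card_funcsetE)
qed

lemma fibre_permute:
  assumes "\<tau> permutes D"
  shows "fibre D (x \<circ> inv \<tau>) s = \<tau> ` fibre D x s"
proof
  show "fibre D (x \<circ> inv \<tau>) s \<subseteq> \<tau> ` fibre D x s"
  proof
    fix d assume "d \<in> fibre D (x \<circ> inv \<tau>) s"
    then have "inv \<tau> d \<in> fibre D x s"
      using permutes_in_image[OF permutes_inv[OF assms]] by (auto simp: fibre_def)
    then show "d \<in> \<tau> ` fibre D x s" using permutes_inverses(1)[OF assms] by (metis imageI)
  qed
  show "\<tau> ` fibre D x s \<subseteq> fibre D (x \<circ> inv \<tau>) s"
    using assms by (auto simp: fibre_def permutes_inverses permutes_in_image)
qed

lemma card_fibre_permute:
  assumes "\<tau> permutes D"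
  shows "card (fibre D (x \<circ> inv \<tau>) s) = card (fibre D x s)"
  using permutes_inj_on[OF assms] by (simp add: fibre_permute[OF assms] card_image)

lemma quota_words_permute:
  assumes "\<tau> permutes D" and x: "x \<in> quota_words S q D B"
  shows "x \<circ> inv \<tau> \<in> quota_words S q D (\<tau> ` B)"
proof -
  have "x \<circ> inv \<tau> \<in> D \<rightarrow>\<^sub>E S"
    using x permutes_in_image[OF permutes_inv[OF assms(1)]]
      permutes_not_in[OF permutes_inv[OF assms(1)]]
    by (auto simp: quota_words_def PiE_iff extensional_def)
  moreover have "card (\<tau> ` B \<inter> fibre D (x \<circ> inv \<tau>) s) = card (B \<inter> fibre D x s)" for s
    using permutes_inj[OF assms(1)] permutes_inj_on[OF assms(1)]
    by (simp add: fibre_permute[OF assms(1)] image_Int[symmetric] card_image)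
  ultimately show ?thesis
    using x by (simp add: quota_words_def card_fibre_permute[OF assms(1)])
qed

lemma sum_quota_weight_permute:
  assumes \<tau>: "\<tau> permutes D"
  shows "sum (quota_weight S q D) (quota_words S q D (\<tau> ` B))
       = sum (quota_weight S q D) (quota_words S q D B)"
proof (rule sum.reindex_bij_witness[where i = "\<lambda>x. x \<circ> inv \<tau>" and j = "\<lambda>x. x \<circ> inv (inv \<tau>)"])
  note inv_\<tau> = permutes_inv[OF \<tau>]
  show "x \<circ> inv \<tau> \<in> quota_words S q D (\<tau> ` B)" if "x \<in> quota_words S q D B" for x
    using quota_words_permute[OF \<tau> that] .
  show "x \<circ> inv (inv \<tau>) \<in> quota_words S q D B" if "x \<in> quota_words S q D (\<tau> ` B)" for x
    using quota_words_permute[OF inv_\<tau> that] permutes_inj[OF \<tau>] by (simp add: image_image inv_f_f)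
  show "quota_weight S q D (x \<circ> inv (inv \<tau>)) = quota_weight S q D x" for x
    unfolding quota_weight_def card_fibre_permute[OF inv_\<tau>] ..
qed (simp_all add: comp_assoc permutes_inv_inv[OF \<tau>] permutes_inv_o[OF \<tau>])

lemma card_quota_sets_times_weight_le:
  assumes "finite D" and "finite S" and "x \<in> D \<rightarrow>\<^sub>E S"
  shows "card {B. B \<subseteq> D \<and> x \<in> quota_words S q D B} * quota_weight S q D x \<le> 1"
proof -
  let ?c = "\<lambda>s. card (fibre D x s)"
  let ?Bs = "{B. B \<subseteq> D \<and> x \<in> quota_words S q D B}"
  let ?F = "PiE S (\<lambda>s. {C. C \<subseteq> fibre D x s \<and> card C = min (q s) (?c s)})"
  have "inj_on (\<lambda>B. \<lambda>s\<in>S. B \<inter> fibre D x s) ?Bs"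
  proof (rule inj_on_inverseI[where g = "\<lambda>f. \<Union> (f ` S)"])
    fix B assume "B \<in> ?Bs"
    then show "\<Union> ((\<lambda>s\<in>S. B \<inter> fibre D x s) ` S) = B"
      using assms(3) by (auto simp: fibre_def)
  qed
  moreover have "(\<lambda>B. \<lambda>s\<in>S. B \<inter> fibre D x s) ` ?Bs \<subseteq> ?F"
    by (auto simp: quota_words_def)
  moreover have "finite ?F" using assms(1,2) by (intro finite_PiE) auto
  ultimately have "card ?Bs \<le> card ?F" by (rule card_inj_on_le)
  also have "card ?F = (\<Prod>s\<in>S. ?c s choose min (q s) (?c s))"
    using assms(1,2) by (simp add: card_PiE n_subsets)
  finally have "real (card ?Bs) \<le> (\<Prod>s\<in>S. real (?c s choose min (q s) (?c s)))"
    by (simp flip: of_nat_prod)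
  moreover have "0 < (\<Prod>s\<in>S. real (?c s choose min (q s) (?c s)))"
    by (intro prod_pos) auto
  ultimately show ?thesis by (simp add: quota_weight_def prod_dividef)
qed

lemma quota_words_subset_filling_words:
  assumes "finite D" and "finite S" and "B \<subseteq> D"
  shows "quota_words S q D B \<subseteq> filling_words S q D (card B)"
proof
  fix x assume x: "x \<in> quota_words S q D B"
  have "card B = card (\<Union>s\<in>S. B \<inter> fibre D x s)"
    using x assms(3) by (intro arg_cong[where f = card]) (auto simp: quota_words_def fibre_def)
  also have "\<dots> = (\<Sum>s\<in>S. card (B \<inter> fibre D x s))"
    using assms by (intro card_UN_disjoint) (auto simp: fibre_def)
  also have "\<dots> = (\<Sum>s\<in>S. min (q s) (card (fibre D x s)))"
    using x by (auto simp: quota_words_def)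
  finally show "x \<in> filling_words S q D (card B)"
    using x by (simp add: filling_words_def quota_words_def)
qed

text \<open>By exchangeability of the applications, the total weight of \<open>B\<close> depends on \<open>card B\<close> only.\<close>

lemma sum_quota_weight_le:
  assumes "finite D" and "finite S" and "B \<subseteq> D"
  shows "sum (quota_weight S q D) (quota_words S q D B) * (card D choose card B)
       \<le> card (filling_words S q D (card B))"
proof -
  let ?C = "{C. C \<subseteq> D \<and> card C = card B}"
  let ?F = "filling_words S q D (card B)" and ?w = "quota_weight S q D"
  have "finite ?C" using assms(1) by simp
  have "sum ?w (quota_words S q D B) * (card D choose card B)
      = (\<Sum>C\<in>?C. sum ?w (quota_words S q D B))"
    using n_subsets[OF assms(1)] by simp
  also have "\<dots> = (\<Sum>C\<in>?C. sum ?w (quota_words S q D C))"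
  proof (rule sum.cong[OF refl])
    fix C assume "C \<in> ?C"
    then obtain \<tau> where "\<tau> permutes D" "\<tau> ` B = C"
      using ex_permutes_image_eq[OF assms(1,3), of C] by auto
    then show "sum ?w (quota_words S q D B) = sum ?w (quota_words S q D C)"
      using sum_quota_weight_permute by metis
  qed
  also have "\<dots> = (\<Sum>C\<in>?C. sum ?w {x \<in> ?F. x \<in> quota_words S q D C})"
  proof (rule sum.cong[OF refl])
    fix C assume "C \<in> ?C"
    then have "quota_words S q D C \<subseteq> ?F"
      using quota_words_subset_filling_words[OF assms(1,2), of C] by simp
    then show "sum ?w (quota_words S q D C) = sum ?w {x \<in> ?F. x \<in> quota_words S q D C}"
      by (intro arg_cong[where f = "sum ?w"]) blast
  qed
  also have "\<dots> = (\<Sum>x\<in>?F. \<Sum>C | C \<in> ?C \<and> x \<in> quota_words S q D C. ?w x)"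
    using assms(1,2) \<open>finite ?C\<close> by (intro sum.swap_restrict) auto
  also have "\<dots> \<le> (\<Sum>x\<in>?F. 1)"
  proof (rule sum_mono)
    fix x assume "x \<in> ?F"
    then have x: "x \<in> D \<rightarrow>\<^sub>E S" by (simp add: filling_words_def)
    have "(\<Sum>C | C \<in> ?C \<and> x \<in> quota_words S q D C. ?w x)
        \<le> card {C. C \<subseteq> D \<and> x \<in> quota_words S q D C} * ?w x"
      using assms(1) by (auto intro!: mult_right_mono card_mono simp: quota_weight_nonneg)
    also have "\<dots> \<le> 1" using assms(1,2) x by (rule card_quota_sets_times_weight_le)
    finally show "(\<Sum>C | C \<in> ?C \<and> x \<in> quota_words S q D C. ?w x) \<le> 1" .
  qed
  finally show ?thesis by simp
qed

lemma card_missed_le_unfilled: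
  assumes "finite S" and "\<And>s. s \<in> S \<Longrightarrow> 0 < q s" and x: "x \<in> filling_words S q D m"
  shows "m + card (S - x ` D) \<le> sum q S"
proof -
  have "m + card (S - x ` D)
      = (\<Sum>s\<in>S. min (q s) (card (fibre D x s)) + (if s \<in> x ` D then 0 else 1))"
    using x assms(1) by (simp add: filling_words_def sum.distrib sum.If_cases Diff_eq)
  also have "\<dots> \<le> sum q S"
  proof (rule sum_mono)
    fix s assume "s \<in> S"
    moreover have "fibre D x s = {}" if "s \<notin> x ` D" using that by (auto simp: fibre_def)
    ultimately show "min (q s) (card (fibre D x s)) + (if s \<in> x ` D then 0 else 1) \<le> q s"
      using assms(2)[of s] by auto
  qed
  finally show ?thesis .
qed

section \<open>Truncated geometric distributions\<close>

lemma power_div_fact_le_mode: "real a ^ j / fact j \<le> real a ^ a / fact a"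
proof (cases "a \<le> j")
  case True
  then show ?thesis
  proof (induction j rule: dec_induct)
    case (step j)
    have "real a ^ Suc j / fact (Suc j) = (real a / real (Suc j)) * (real a ^ j / fact j)"
      by simp
    also have "\<dots> \<le> 1 * (real a ^ j / fact j)"
      using step.hyps by (intro mult_right_mono) auto
    finally show ?case using step.IH by simp
  qed simp
next
  case False
  then have "j \<le> a" by simp
  then show ?thesis
  proof (induction j rule: inc_induct)
    case (step j)
    have "1 * (real a ^ j / fact j) \<le> (real a / real (Suc j)) * (real a ^ j / fact j)"
      using step.hyps by (intro mult_right_mono) auto
    also have "\<dots> = real a ^ Suc j / fact (Suc j)" by simp
    finally show ?case using step.IH by simp
  qed simp
qed

lemma binomial_term_le_mode:
  assumes "j \<le> a + b"
  shows "real (a + b choose j) * real a ^ j * real b ^ (a + b - j)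
       \<le> real (a + b choose a) * real a ^ a * real b ^ b"
proof -
  have "real (a + b choose j) * real a ^ j * real b ^ (a + b - j)
      = fact (a + b) * ((real a ^ j / fact j) * (real b ^ (a + b - j) / fact (a + b - j)))"
    using assms by (simp add: binomial_fact)
  also have "\<dots> \<le> fact (a + b) * ((real a ^ a / fact a) * (real b ^ b / fact b))"
    by (intro mult_left_mono mult_mono power_div_fact_le_mode) auto
  also have "\<dots> = real (a + b choose a) * real a ^ a * real b ^ b" by (simp add: binomial_fact)
  finally show ?thesis .
qed

lemma inverse_binomial_le:
  assumes "0 < a + b" and p: "p = real a / real (a + b)"
  shows "1 / real (a + b choose a) \<le> real (a + b + 1) * (p ^ a * (1 - p) ^ b)"
proof -
  define M where "M = real (a + b)"
  have "0 < M" using assms(1) by (simp add: M_def del: of_nat_add)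
  let ?mode = "real (a + b choose a) * real a ^ a * real b ^ b"
  have "M ^ (a + b) = (\<Sum>j\<le>a + b. real (a + b choose j) * real a ^ j * real b ^ (a + b - j))"
    by (simp add: M_def binomial_ring)
  also have "\<dots> \<le> (\<Sum>j\<le>a + b. ?mode)"
    by (intro sum_mono binomial_term_le_mode) simp
  finally have "1 \<le> real (a + b + 1) * ?mode / M ^ (a + b)"
    using \<open>0 < M\<close> by (simp add: le_divide_eq)
  also have "\<dots> = real (a + b + 1) * (real (a + b choose a) * ((a / M) ^ a * (b / M) ^ b))"
    by (simp add: power_divide power_add)
  also have "a / M = p" by (simp add: p M_def)
  also have "b / M = 1 - p" using \<open>0 < M\<close> by (simp add: p M_def field_simps)
  finally show ?thesis by (simp add: divide_le_eq mult_ac add_ac)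
qed

definition trunc_geom :: "nat \<Rightarrow> real \<Rightarrow> nat \<Rightarrow> real" where
  "trunc_geom K p j = (1 - p) ^ j * (if j < K then p else 1)"

lemma trunc_geom_nonneg: "0 \<le> p \<Longrightarrow> p \<le> 1 \<Longrightarrow> 0 \<le> trunc_geom K p j"
  by (simp add: trunc_geom_def)

lemma sum_trunc_geom: "(\<Sum>j\<le>K. trunc_geom K p j) = 1"
proof -
  have "(\<Sum>j<m. (1 - p) ^ j * p) + (1 - p) ^ m = 1" for m
    by (induction m) (simp_all add: algebra_simps)
  then show ?thesis
    by (simp add: trunc_geom_def lessThan_Suc_atMost[symmetric])
qed

lemma sum_trunc_geom_low_le:
  assumes "0 \<le> p" and "p \<le> 1" and "k \<le> K"
  shows "(\<Sum>j<k. trunc_geom K p j) \<le> k * p"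
proof -
  have "trunc_geom K p j \<le> p" if "j < k" for j
    using that assms mult_right_mono[of "(1 - p) ^ j" 1 p]
    by (simp add: trunc_geom_def power_le_one)
  then show ?thesis using sum_bounded_above[of "{..<k}" "trunc_geom K p" p] by simp
qed

lemma sum_trunc_geom_inflated_le:
  assumes p: "0 \<le> p" "p \<le> 1" and "k \<le> K" and c: "k * p \<le> c" "0 < c"
  shows "(\<Sum>j\<le>K. trunc_geom K p j * (if j < k then 1 / c else 1)) \<le> 2"
proof -
  have "(\<Sum>j\<le>K. trunc_geom K p j * (if j < k then 1 / c else 1))
      \<le> (\<Sum>j\<le>K. trunc_geom K p j + (if j < k then trunc_geom K p j / c else 0))"
    using p by (intro sum_mono) (simp add: trunc_geom_nonneg)
  also have "\<dots> = 1 + (\<Sum>j\<le>K. if j < k then trunc_geom K p j / c else 0)"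
    by (simp add: sum.distrib sum_trunc_geom)
  also have "(\<Sum>j\<le>K. if j < k then trunc_geom K p j / c else 0) = (\<Sum>j<k. trunc_geom K p j) / c"
    unfolding sum_divide_distrib using assms(3) by (intro sum.mono_neutral_cong_right) auto
  also have "\<dots> \<le> 1" using order.trans[OF sum_trunc_geom_low_le[OF p assms(3)] c(1)] c(2) by simp
  finally show ?thesis by simp
qed

definition trunc_geom_weight :: "'i set \<Rightarrow> nat \<Rightarrow> real \<Rightarrow> ('i \<Rightarrow> nat) \<Rightarrow> real" where
  "trunc_geom_weight I K p r = (\<Prod>i\<in>I. trunc_geom K p (r i))"

lemma trunc_geom_weight_nonneg: "0 \<le> p \<Longrightarrow> p \<le> 1 \<Longrightarrow> 0 \<le> trunc_geom_weight I K p r"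
  unfolding trunc_geom_weight_def by (intro prod_nonneg) (auto simp: trunc_geom_nonneg)

lemma sum_trunc_geom_weight:
  assumes "finite I"
  shows "sum (trunc_geom_weight I K p) (I \<rightarrow>\<^sub>E {..K}) = 1"
  using assms unfolding trunc_geom_weight_def
  by (subst prod_sum_PiE[symmetric]) (simp_all add: sum_trunc_geom)

lemma sum_trunc_geom_weight_le_1:
  assumes "finite I" and "0 \<le> p" and "p \<le> 1" and "R \<subseteq> I \<rightarrow>\<^sub>E {..K}"
  shows "sum (trunc_geom_weight I K p) R \<le> 1"
proof -
  have "sum (trunc_geom_weight I K p) R \<le> sum (trunc_geom_weight I K p) (I \<rightarrow>\<^sub>E {..K})"
    using assms by (intro sum_mono2 finite_PiE) (auto simp: trunc_geom_weight_nonneg)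
  then show ?thesis using assms(1) by (simp add: sum_trunc_geom_weight)
qed

lemma sum_trunc_geom_weight_many_low_le:
  fixes k K :: nat and c p \<delta> :: real
  assumes "finite I" and p: "0 \<le> p" "p \<le> 1" and "k \<le> K" and c: "k * p \<le> c" "0 < c" "c \<le> 1"
    and R: "R \<subseteq> {r \<in> I \<rightarrow>\<^sub>E {..K}. \<delta> \<le> card {i \<in> I. r i < k}}"
  shows "sum (trunc_geom_weight I K p) R \<le> 2 ^ card I * c powr \<delta>"
proof -
  let ?h = "\<lambda>j. trunc_geom K p j * (if j < k then 1 / c else 1)"
  have nonneg: "0 \<le> ?h j" for j using p c by (simp add: trunc_geom_nonneg)
  have "sum (trunc_geom_weight I K p) R \<le> (\<Sum>r\<in>R. c powr \<delta> * (\<Prod>i\<in>I. ?h (r i)))"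
  proof (rule sum_mono)
    fix r assume "r \<in> R"
    then have "c ^ card {i \<in> I. r i < k} \<le> c powr \<delta>"
      using R c powr_mono'[of \<delta> "card {i \<in> I. r i < k}" c] by (auto simp: powr_realpow)
    then have "1 * trunc_geom_weight I K p r
        \<le> (c powr \<delta> * (1 / c) ^ card {i \<in> I. r i < k}) * trunc_geom_weight I K p r"
      using p c by (intro mult_right_mono) (auto simp: trunc_geom_weight_nonneg power_divide)
    also have "\<dots> = c powr \<delta> * (\<Prod>i\<in>I. ?h (r i))"
      using assms(1) by (simp add: trunc_geom_weight_def prod.distrib prod.If_cases Int_def)
    finally show "trunc_geom_weight I K p r \<le> c powr \<delta> * (\<Prod>i\<in>I. ?h (r i))" by simp
  qed
  also have "\<dots> \<le> (\<Sum>r\<in>I \<rightarrow>\<^sub>E {..K}. c powr \<delta> * (\<Prod>i\<in>I. ?h (r i)))"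
    using assms(1) p c R
    by (intro sum_mono2 finite_PiE mult_nonneg_nonneg prod_nonneg) (auto simp: trunc_geom_nonneg)
  also have "\<dots> = c powr \<delta> * (\<Prod>i\<in>I. \<Sum>j\<le>K. ?h j)"
    using assms(1) by (subst prod_sum_PiE) (simp_all add: sum_distrib_left)
  also have "\<dots> \<le> c powr \<delta> * (\<Prod>i\<in>I. 2)"
    using nonneg sum_trunc_geom_inflated_le[OF p assms(4) c(1,2)]
    by (intro mult_left_mono prod_mono) (auto intro!: sum_nonneg)
  finally show ?thesis by (simp add: mult.commute)
qed

section \<open>Transcripts\<close>

text \<open>A pair \<open>(i, j)\<close> stands for the application of student \<open>i\<close> to her \<open>j\<close>-th choice.\<close>

definition applications :: "'i set \<Rightarrow> nat \<Rightarrow> ('i \<Rightarrow> nat) \<Rightarrow> ('i \<times> nat) set" where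
  "applications I c r = (SIGMA i:I. {..<min (Suc (r i)) c})"

definition accepted_applications :: "'i set \<Rightarrow> nat \<Rightarrow> ('i \<Rightarrow> nat) \<Rightarrow> ('i \<times> nat) set" where
  "accepted_applications I c r = (\<lambda>i. (i, r i)) ` {i \<in> I. r i < c}"

lemma finite_applications [simp]: "finite I \<Longrightarrow> finite (applications I c r)"
  by (simp add: applications_def)

lemma accepted_applications_subset: "accepted_applications I c r \<subseteq> applications I c r"
  by (auto simp: accepted_applications_def applications_def)

lemma applications_cong:
  "(\<And>i. i \<in> I \<Longrightarrow> r i = r' i) \<Longrightarrow> applications I c r = applications I c r'"
  by (simp add: applications_def cong: Sigma_cong)

lemma applications_restrict [simp]: "applications I c (restrict r I) = applications I c r"
  by (rule applications_cong) simp

lemma accepted_applications_cong: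
  "(\<And>i. i \<in> I \<Longrightarrow> r i = r' i) \<Longrightarrow> accepted_applications I c r = accepted_applications I c r'"
  by (auto simp: accepted_applications_def)

lemma card_accepted_applications: "card (accepted_applications I c r) = card {i \<in> I. r i < c}"
  unfolding accepted_applications_def by (intro card_image) (auto simp: inj_on_def)

lemma card_applications:
  assumes "finite I" and "r \<in> I \<rightarrow> {..c}"
  shows "card (applications I c r) = card (accepted_applications I c r) + sum r I"
proof -
  have "min (Suc (r i)) c = (if r i < c then 1 else 0) + r i" if "i \<in> I" for i
    using assms(2) that by (fastforce simp: Pi_iff)
  then show ?thesis
    using assms(1)
    by (simp add: applications_def sum.distrib sum.If_cases Int_def card_accepted_applications)
qed

lemma trunc_geom_weight_eq_power:
  assumes "finite I"
  shows "trunc_geom_weight I K p r = p ^ card (accepted_applications I K r) * (1 - p) ^ sum r I"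
  using assms by (simp add: trunc_geom_weight_def trunc_geom_def card_accepted_applications
      prod.distrib power_sum prod.If_cases Int_def)

context strict_school_choice
begin

definition transcript :: "nat \<Rightarrow> 'i \<times> nat \<Rightarrow> 's" where
  "transcript c = restrict (\<lambda>(i, j). P i j) (applications I c (final c))"

context
  fixes c :: nat and D B :: "('i \<times> nat) set"
  assumes c: "c \<le> L"
  defines "D \<equiv> applications I c (final c)" and "B \<equiv> accepted_applications I c (final c)"
begin

lemma rejected_applicationD:
  assumes "(i, j) \<in> fibre D (transcript c) s - B"
  shows "i \<in> I" and "j < final c i" and "P i j = s"
proof -
  have "(i, j) \<in> D" "(i, j) \<notin> B" and s: "transcript c (i, j) = s"
    using assms by (auto simp: fibre_def)
  then have i: "i \<in> I" "j < min (Suc (final c i)) c" by (auto simp: D_def applications_def)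
  then have "j \<noteq> final c i"
    using \<open>(i, j) \<notin> B\<close> by (auto simp: B_def accepted_applications_def)
  with i show "i \<in> I" "j < final c i" by auto
  show "P i j = s" using s \<open>(i, j) \<in> D\<close> by (simp add: transcript_def D_def)
qed

lemma accepted_Int_fibre:
  "B \<inter> fibre D (transcript c) s = (\<lambda>i. (i, final c i)) ` holders c (final c) s"
  by (auto simp: B_def D_def accepted_applications_def applications_def fibre_def transcript_def
      holders_def)

lemma transcript_in_quota_words:
  assumes schools: "\<And>i j. \<lbrakk>i \<in> I; j < c\<rbrakk> \<Longrightarrow> P i j \<in> S"
  shows "transcript c \<in> quota_words S quota D B"
proof -
  have "card (B \<inter> fibre D (transcript c) s) = min (quota s) (card (fibre D (transcript c) s))" for s
  proof -
    let ?F = "fibre D (transcript c) s"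
    have accepted: "card (B \<inter> ?F) = card (holders c (final c) s)"
      unfolding accepted_Int_fibre by (intro card_image inj_onI) simp
    have le_quota: "card (holders c (final c) s) \<le> quota s" using c by (rule card_holders_final_le)
    show ?thesis
    proof (cases "?F \<subseteq> B")
      case True
      then show ?thesis using accepted le_quota by (simp add: Int_absorb1)
    next
      case False
      then obtain i j where "(i, j) \<in> ?F - B" by fastforce
      then have "card (holders c (final c) s) = quota s"
        using rejected_applicationD card_rejecter_holders[OF c] by metis
      moreover have "card (B \<inter> ?F) \<le> card ?F"
        using finite_students by (intro card_mono) (auto simp: D_def)
      ultimately show ?thesis using accepted by simp
    qed
  qed
  moreover have "transcript c \<in> D \<rightarrow>\<^sub>E S"
    using schools by (auto simp: transcript_def D_def applications_def)
  ultimately show ?thesis by (simp add: quota_words_def)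
qed

lemma inj_on_fst_fibre_transcript:
  assumes "\<And>i. i \<in> I \<Longrightarrow> inj_on (P i) {..<c}"
  shows "inj_on fst (fibre D (transcript c) s)"
proof (rule inj_onI, clarsimp)
  fix i j j' assume "(i, j) \<in> fibre D (transcript c) s" "(i, j') \<in> fibre D (transcript c) s"
  then have "i \<in> I" "j < c" "j' < c" "P i j = P i j'"
    by (auto simp: fibre_def D_def transcript_def applications_def)
  then show "j = j'" using assms by (auto dest: inj_onD)
qed

lemma rank_accepted_less_rejected:
  assumes "a \<in> fst ` (B \<inter> fibre D (transcript c) s)" and "b \<in> fst ` (fibre D (transcript c) s - B)"
  shows "rank s a < rank s b"
proof -
  have "a \<in> holders c (final c) s" using assms(1) unfolding accepted_Int_fibre by auto
  moreover obtain j where "(b, j) \<in> fibre D (transcript c) s - B" using assms(2) by auto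
  ultimately show ?thesis
    using rejected_applicationD rejecter_holders_better[OF c, of b j]
    by (auto simp: better_holders_def)
qed

end

end

section \<open>The probability of a vector of rejection counts\<close>

lemma card_profiles: "card (profiles n q) = fact n ^ (n * q) * fact (n * q) ^ n"
  by (simp add: profiles_def card_cartesian_product card_PiE card_permutations)

lemma finite_profiles [simp]: "finite (profiles n q)"
  unfolding profiles_def
  by (intro finite_cartesian_product finite_PiE) (auto simp: finite_permutations)

lemma profiles_nonempty [simp]: "profiles n q \<noteq> {}"
  using card_profiles[of n q] by (metis card.empty fact_nonzero mult_eq_0_iff power_not_zero)

lemma profiles_permutes:
  assumes "(P, Q) \<in> profiles n q"
  shows "i < n * q \<Longrightarrow> P i permutes {..<n}" and "s < n \<Longrightarrow> Q s permutes {..<n * q}"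
  using assms by (auto simp: profiles_def PiE_iff)

lemma profiles_choice_less:
  assumes "(P, Q) \<in> profiles n q" and "i < n * q" and "j < n"
  shows "P i j < n"
  using permutes_in_image[OF profiles_permutes(1)[OF assms(1,2)]] assms(3) by simp

lemma profiles_strict_school_choice:
  assumes "(P, Q) \<in> profiles n q"
  shows "strict_school_choice {..<n * q} P (\<lambda>s. inv (Q s)) n"
proof
  fix i j assume "i \<in> {..<n * q}" "j < n"
  then have "Q (P i j) permutes {..<n * q}"
    using assms profiles_choice_less profiles_permutes(2) by simp
  then show "inj_on (inv (Q (P i j))) {..<n * q}"
    by (intro permutes_inj_on[OF permutes_inv])
qed simp

abbreviation capped_DA ::
  "nat \<Rightarrow> nat \<Rightarrow> nat \<Rightarrow> (nat \<Rightarrow> nat \<Rightarrow> nat) \<Rightarrow> (nat \<Rightarrow> nat \<Rightarrow> nat) \<Rightarrow> nat \<Rightarrow> nat" where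
  "capped_DA n q c P Q \<equiv> school_choice.final {..<n * q} (\<lambda>_. q) P (\<lambda>s. inv (Q s)) c"

lemma da_final_eq_capped_DA: "da_final n q P Q = capped_DA n q n P Q"
proof -
  interpret school_choice "{..<n * q}" "\<lambda>_. q" P "\<lambda>s. inv (Q s)" .
  have "da_rejected n q P Q = rejected n"
    by (intro ext)
      (simp add: da_rejected_def rejected_def better_holders_def holders_def conj_assoc)
  moreover from this have "da_step n q P Q = step n"
    by (intro ext) (simp add: da_step_def step_def)
  ultimately show ?thesis by (simp add: da_final_def final_def state_def Let_def)
qed

type_synonym profile = "(nat \<Rightarrow> nat \<Rightarrow> nat) \<times> (nat \<Rightarrow> nat \<Rightarrow> nat)"

abbreviation profile_prob :: "nat \<Rightarrow> nat \<Rightarrow> profile set \<Rightarrow> real" where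
  "profile_prob n q \<equiv> measure_pmf.prob (pmf_of_set (profiles n q))"

lemma profile_prob_mono:
  assumes "\<And>P Q. (P, Q) \<in> profiles n q \<Longrightarrow> (P, Q) \<in> X \<Longrightarrow> (P, Q) \<in> Y"
  shows "profile_prob n q X \<le> profile_prob n q Y"
proof -
  have "profiles n q \<inter> X \<subseteq> profiles n q \<inter> Y" using assms by auto
  then have "card (profiles n q \<inter> X) \<le> card (profiles n q \<inter> Y)" by (intro card_mono) auto
  then show ?thesis by (simp add: measure_pmf_of_set divide_right_mono)
qed

definition matching_preferences ::
  "nat \<Rightarrow> 'i set \<Rightarrow> ('i \<times> nat) set \<Rightarrow> ('i \<times> nat \<Rightarrow> nat) \<Rightarrow> ('i \<Rightarrow> nat \<Rightarrow> nat) set" where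
  "matching_preferences n I D x =
     PiE I (\<lambda>i. {p. p permutes {..<n} \<and> (\<forall>j\<in>D `` {i}. p j = x (i, j))})"

definition matching_priorities ::
  "'i::linorder set \<Rightarrow> 's set \<Rightarrow> ('i \<times> nat) set \<Rightarrow> ('i \<times> nat) set \<Rightarrow> ('i \<times> nat \<Rightarrow> 's)
    \<Rightarrow> ('s \<Rightarrow> 'i \<Rightarrow> 'i) set" where
  "matching_priorities U S D B x =
     PiE S (\<lambda>s. separating_permutations U (fst ` (B \<inter> fibre D x s)) (fst ` (fibre D x s - B)))"

lemma finite_matching_preferences [simp]: "finite I \<Longrightarrow> finite (matching_preferences n I D x)"
  unfolding matching_preferences_def
  by (intro finite_PiE finite_subset[OF _ finite_permutations[of "{..<n}"]]) auto

lemma finite_matching_priorities [simp]: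
  "finite U \<Longrightarrow> finite S \<Longrightarrow> finite (matching_priorities U S D B x)"
  unfolding matching_priorities_def by (intro finite_PiE) auto

lemma fact_diff_mult_power_le:
  assumes "l \<le> K" and "K \<le> n"
  shows "fact (n - l) * (n - K) ^ l \<le> (fact n :: nat)"
proof -
  have "(n - K) ^ l \<le> (\<Prod>i<l. n - i)"
    using assms(1) prod_mono[of "{..<l}" "\<lambda>_. n - K" "\<lambda>i. n - i"] by simp
  then show ?thesis
    using prod_diff_mult_fact[of l n] assms mult_le_mono2 by (metis mult.commute order.trans)
qed

lemma card_matching_preferences_le:
  assumes "finite I" and D: "D \<subseteq> I \<times> {..<K}" and "K \<le> n"
  shows "card (matching_preferences n I D x) * (n - K) ^ card D \<le> fact n ^ card I"
proof -
  let ?P = "\<lambda>i. {p. p permutes {..<n} \<and> (\<forall>j\<in>D `` {i}. p j = x (i, j))}"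
  have section_subset: "D `` {i} \<subseteq> {..<K}" for i using D by blast
  then have fin: "finite (D `` {i})" "card (D `` {i}) \<le> K" for i
    using finite_subset[OF section_subset] card_mono[OF _ section_subset] by auto
  have "D = (SIGMA i:I. D `` {i})" using D by blast
  then have "card D = (\<Sum>i\<in>I. card (D `` {i}))" using assms(1) fin(1) by (metis card_SigmaI)
  then have "card (matching_preferences n I D x) * (n - K) ^ card D
      = (\<Prod>i\<in>I. card (?P i) * (n - K) ^ card (D `` {i}))"
    using assms(1) by (simp add: matching_preferences_def card_PiE power_sum prod.distrib)
  also have "\<dots> \<le> (\<Prod>i\<in>I. fact n)"
  proof (intro prod_mono conjI)
    fix i
    have "D `` {i} \<subseteq> {..<n}" using section_subset[of i] assms(3) by force
    then have "card (?P i) \<le> fact (n - card (D `` {i}))"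
      using card_permutations_prescribed_le[of "{..<n}" "D `` {i}"] by simp
    then show "card (?P i) * (n - K) ^ card (D `` {i}) \<le> fact n"
      using fact_diff_mult_power_le[OF fin(2) assms(3)] mult_le_mono1 order.trans by blast
  qed simp
  finally show ?thesis by simp
qed

lemma card_matching_priorities_le:
  assumes fin: "finite D" "finite U" "finite S" and U: "fst ` D \<subseteq> U"
    and x: "x \<in> quota_words S q D B" and inj: "\<And>s. s \<in> S \<Longrightarrow> inj_on fst (fibre D x s)"
  shows "card (matching_priorities U S D B x) \<le> fact (card U) ^ card S * quota_weight S q D x"
proof -
  let ?F = "fibre D x"
  let ?Q = "\<lambda>s. separating_permutations U (fst ` (B \<inter> ?F s)) (fst ` (?F s - B))"
  let ?m = "\<lambda>s. min (q s) (card (?F s))"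
  have single: "card (?Q s) \<le> fact (card U) * (1 / real (card (?F s) choose ?m s))"
    if "s \<in> S" for s
  proof -
    note inj_F = inj[OF \<open>s \<in> S\<close>]
    have "card (fst ` (B \<inter> ?F s)) = card (B \<inter> ?F s)" "card (fst ` (?F s - B)) = card (?F s - B)"
      by (intro card_image inj_on_subset[OF inj_F]; blast)+
    moreover have "card (B \<inter> ?F s) + card (?F s - B) = card (?F s)"
      using card_Int_Diff[OF finite_fibre[OF fin(1)], of x s B] by (simp add: Int_commute)
    moreover have "card (B \<inter> ?F s) = ?m s"
      using x \<open>s \<in> S\<close> by (simp add: quota_words_def)
    moreover have "fst ` (B \<inter> ?F s) \<subseteq> U" "fst ` (?F s - B) \<subseteq> U" using U by (auto simp: fibre_def)
    moreover have "fst ` (B \<inter> ?F s) \<inter> fst ` (?F s - B) = {}" using inj_F by (auto dest: inj_onD)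
    ultimately have "card (?Q s) * (card (?F s) choose ?m s) \<le> fact (card U)"
      using card_separating_permutations_le[OF fin(2)] by metis
    then have "real (card (?Q s)) * real (card (?F s) choose ?m s) \<le> fact (card U)"
      by (metis of_nat_fact of_nat_le_iff of_nat_mult)
    then show ?thesis by (simp add: field_simps)
  qed
  have "real (card (matching_priorities U S D B x)) = (\<Prod>s\<in>S. real (card (?Q s)))"
    using fin(3) by (simp add: matching_priorities_def card_PiE)
  also have "\<dots> \<le> (\<Prod>s\<in>S. fact (card U) * (1 / real (card (?F s) choose ?m s)))"
    using single by (intro prod_mono) auto
  also have "\<dots> = fact (card U) ^ card S * quota_weight S q D x"
    unfolding quota_weight_def prod.distrib by simp
  finally show ?thesis .
qed

definition rejections_event ::
  "nat \<Rightarrow> nat \<Rightarrow> nat \<Rightarrow> (nat \<Rightarrow> nat) \<Rightarrow> profile set" where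
  "rejections_event n q K r = {(P, Q). \<forall>i<n * q. capped_DA n q K P Q i = r i}"

context
  fixes n q K :: nat and r :: "nat \<Rightarrow> nat" and D B :: "(nat \<times> nat) set"
  assumes K: "K \<le> n"
  defines "D \<equiv> applications {..<n * q} K r" and "B \<equiv> accepted_applications {..<n * q} K r"
begin

lemma rejections_event_subset_matching:
  "profiles n q \<inter> rejections_event n q K r \<subseteq>
    (\<Union>x\<in>{x \<in> quota_words {..<n} (\<lambda>_. q) D B. \<forall>s<n. inj_on fst (fibre D x s)}.
       matching_preferences n {..<n * q} D x \<times> matching_priorities {..<n * q} {..<n} D B x)"
    (is "_ \<subseteq> (\<Union>x\<in>?X. _)")
proof clarify
  fix P Q assume PQ: "(P, Q) \<in> profiles n q" and r: "(P, Q) \<in> rejections_event n q K r"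
  interpret strict_school_choice "{..<n * q}" "\<lambda>_. q" P "\<lambda>s. inv (Q s)" n
    using PQ by (rule profiles_strict_school_choice)
  let ?x = "transcript K"
  have "r i = final K i" if "i \<in> {..<n * q}" for i
    using r that by (simp add: rejections_event_def)
  then have D: "D = applications {..<n * q} K (final K)"
    and B: "B = accepted_applications {..<n * q} K (final K)"
    unfolding D_def B_def by (auto intro!: applications_cong accepted_applications_cong)
  have "?x \<in> quota_words {..<n} (\<lambda>_. q) D B"
    unfolding D B using K profiles_choice_less[OF PQ] by (intro transcript_in_quota_words) auto
  moreover have "inj_on fst (fibre D ?x s)" for s
    unfolding D using K permutes_inj_on[OF profiles_permutes(1)[OF PQ]]
    by (intro inj_on_fst_fibre_transcript) auto
  moreover have "P \<in> matching_preferences n {..<n * q} D ?x"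
    using PQ by (auto simp: matching_preferences_def profiles_def PiE_iff D transcript_def)
  moreover have "Q \<in> matching_priorities {..<n * q} {..<n} D B ?x"
    using PQ rank_accepted_less_rejected[OF K]
    by (auto simp: matching_priorities_def separating_permutations_def profiles_def PiE_iff D B)
  ultimately show "(P, Q) \<in> (\<Union>x\<in>?X. matching_preferences n {..<n * q} D x
      \<times> matching_priorities {..<n * q} {..<n} D B x)"
    by blast
qed

lemma card_rejections_event_le:
  "card (profiles n q \<inter> rejections_event n q K r) * real (n - K) ^ card D
     \<le> card (profiles n q) * sum (quota_weight {..<n} (\<lambda>_. q) D) (quota_words {..<n} (\<lambda>_. q) D B)"
proof -
  let ?W = "quota_words {..<n} (\<lambda>_. q) D B" and ?w = "quota_weight {..<n} (\<lambda>_. q) D"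
  let ?X = "{x \<in> ?W. \<forall>s<n. inj_on fst (fibre D x s)}"
  let ?P = "matching_preferences n {..<n * q} D"
  let ?Q = "matching_priorities {..<n * q} {..<n} D B"
  have D_subset: "D \<subseteq> {..<n * q} \<times> {..<K}" by (auto simp: D_def applications_def)
  have finW: "finite ?W" by (simp add: D_def)
  have "card (profiles n q \<inter> rejections_event n q K r) \<le> card (\<Union>x\<in>?X. ?P x \<times> ?Q x)"
    using finW by (intro card_mono rejections_event_subset_matching) auto
  also have "\<dots> \<le> (\<Sum>x\<in>?X. card (?P x \<times> ?Q x))" using finW by (intro card_UN_le) simp
  finally have "real (card (profiles n q \<inter> rejections_event n q K r))
      \<le> (\<Sum>x\<in>?X. real (card (?P x)) * real (card (?Q x)))"
    by (simp add: card_cartesian_product flip: of_nat_mult of_nat_sum)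
  then have "card (profiles n q \<inter> rejections_event n q K r) * real (n - K) ^ card D
      \<le> (\<Sum>x\<in>?X. real (card (?P x)) * real (card (?Q x))) * real (n - K) ^ card D"
    by (intro mult_right_mono) auto
  also have "\<dots> = (\<Sum>x\<in>?X. real (card (?P x) * (n - K) ^ card D) * real (card (?Q x)))"
    unfolding sum_distrib_right by (intro sum.cong refl) simp
  also have "\<dots> \<le> (\<Sum>x\<in>?X. real (fact n ^ (n * q)) * (fact (n * q) ^ n * ?w x))"
  proof (intro sum_mono mult_mono of_nat_mono)
    fix x assume x: "x \<in> ?X"
    show "card (?P x) * (n - K) ^ card D \<le> fact n ^ (n * q)"
      using card_matching_preferences_le[OF _ D_subset K, of x] by simp
    show "card (?Q x) \<le> fact (n * q) ^ n * ?w x"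
      using x D_subset card_matching_priorities_le[of D "{..<n * q}" "{..<n}" x "\<lambda>_. q" B]
      by (fastforce simp: finite_subset)
  qed auto
  also have "\<dots> \<le> (\<Sum>x\<in>?W. real (fact n ^ (n * q)) * (fact (n * q) ^ n * ?w x))"
    using finW by (intro sum_mono2) (auto simp: quota_weight_nonneg)
  also have "\<dots> = card (profiles n q) * sum ?w ?W"
    by (simp add: card_profiles sum_distrib_left mult_ac)
  finally show ?thesis .
qed

lemma rejections_event_prob_le:
  "profile_prob n q (rejections_event n q K r) * real (n - K) ^ card D * (card D choose card B)
     \<le> card (filling_words {..<n} (\<lambda>_. q) D (card B))"
proof -
  let ?w = "sum (quota_weight {..<n} (\<lambda>_. q) D) (quota_words {..<n} (\<lambda>_. q) D B)"
  have "0 < real (card (profiles n q))" by (simp add: card_gt_0_iff)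
  then have "profile_prob n q (rejections_event n q K r) * real (n - K) ^ card D \<le> ?w"
    using card_rejections_event_le by (simp add: measure_pmf_of_set divide_le_eq mult.commute)
  then have "profile_prob n q (rejections_event n q K r) * real (n - K) ^ card D
        * (card D choose card B) \<le> ?w * (card D choose card B)"
    by (rule mult_right_mono) simp
  also have "\<dots> \<le> card (filling_words {..<n} (\<lambda>_. q) D (card B))"
    using accepted_applications_subset by (intro sum_quota_weight_le) (auto simp: D_def B_def)
  finally show ?thesis .
qed

end

section \<open>Few students are rejected rarely\<close>

lemma exp_neg_le_one_minus_power:
  fixes x y :: real
  assumes "0 \<le> x" and "x \<le> 1 / 2" and "m * x \<le> y"
  shows "exp (- 2 * y) \<le> (1 - x) ^ m"
proof -
  have "2 * x\<^sup>2 \<le> x" using assms(1,2) mult_left_mono[of x "1 / 2" x] by (simp add: power2_eq_square)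
  then have "- 2 * x \<le> ln (1 - x)"
    using ln_one_minus_pos_lower_bound[OF assms(1,2)] by linarith
  then have "exp (- 2 * x) \<le> 1 - x" using assms(2) by (simp add: ln_ge_iff)
  then have "exp (- 2 * x) ^ m \<le> (1 - x) ^ m" by (intro power_mono) auto
  moreover have "exp (- 2 * y) \<le> exp (- 2 * x) ^ m"
    using assms(3) by (simp add: exp_of_nat_mult[symmetric])
  ultimately show ?thesis by linarith
qed

lemma sum_diagonal_le_card_image_mult:
  fixes h :: "'b \<Rightarrow> 'a \<Rightarrow> real" and z :: real
  assumes "finite R" and "\<And>p r. p \<in> f ` R \<Longrightarrow> r \<in> R \<Longrightarrow> 0 \<le> h p r"
    and "\<And>p. p \<in> f ` R \<Longrightarrow> sum (h p) R \<le> z"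
  shows "(\<Sum>r\<in>R. h (f r) r) \<le> card (f ` R) * z"
proof -
  have "(\<Sum>r\<in>R. h (f r) r) = (\<Sum>p\<in>f ` R. \<Sum>r\<in>{r \<in> R. f r = p}. h (f r) r)"
    using assms(1) by (rule sum.image_gen)
  also have "\<dots> = (\<Sum>p\<in>f ` R. sum (h p) {r \<in> R. f r = p})" by simp
  also have "\<dots> \<le> (\<Sum>p\<in>f ` R. sum (h p) R)"
    using assms(1,2) by (intro sum_mono sum_mono2) auto
  also have "\<dots> \<le> card (f ` R) * z" using assms(3) by (rule sum_bounded_above)
  finally show ?thesis .
qed

lemma card_applications_le:
  assumes "finite I"
  shows "card (applications I K r) \<le> K * card I"
  using assms sum_bounded_above[of I "\<lambda>i. min (Suc (r i)) K" K]
  by (simp add: applications_def mult.commute)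

lemma card_accepted_applications_le:
  assumes "finite I"
  shows "card (accepted_applications I K r) \<le> card (applications I K r)"
  using assms by (intro card_mono accepted_applications_subset) simp

lemma card_le_card_applications:
  assumes "finite I" and "0 < K"
  shows "card I \<le> card (applications I K r)"
  using assms sum_bounded_below[of I 1 "\<lambda>i. min (Suc (r i)) K"] by (simp add: applications_def)

text \<open>Every student without an accepted application has been rejected \<open>K\<close> times.\<close>

lemma cap_times_card_le:
  assumes "finite I" and "r \<in> I \<rightarrow> {..K}"
  shows "K * card I \<le> K * card (accepted_applications I K r) + sum r I"
proof -
  have "(\<Sum>i\<in>I. K) \<le> (\<Sum>i\<in>I. (if r i < K then K else 0) + r i)"
    by (intro sum_mono) auto
  then show ?thesis
    using assms(1)
    by (simp add: sum.distrib sum.If_cases Int_def card_accepted_applications mult.commute)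
qed

definition acceptance_rate :: "'i set \<Rightarrow> nat \<Rightarrow> ('i \<Rightarrow> nat) \<Rightarrow> real" where
  "acceptance_rate I K r = card (accepted_applications I K r) / card (applications I K r)"

lemma acceptance_rate_bounds:
  assumes "finite I"
  shows "0 \<le> acceptance_rate I K r" and "acceptance_rate I K r \<le> 1"
  using card_accepted_applications_le[OF assms, of K r]
  by (auto simp: acceptance_rate_def divide_le_eq)

lemma card_acceptance_rates_le:
  assumes "finite I"
  shows "card (acceptance_rate I K ` R) \<le> (K * card I + 1)\<^sup>2"
proof -
  let ?rates = "(\<lambda>(a, m). real a / real m) ` ({..K * card I} \<times> {..K * card I})"
  have "acceptance_rate I K r \<in> ?rates" for r
    using card_applications_le[OF assms, of K r] card_accepted_applications_le[OF assms, of K r]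
    by (auto simp: acceptance_rate_def intro!: image_eqI[where x = "(_, _)"])
  then have "card (acceptance_rate I K ` R) \<le> card ?rates" by (intro card_mono) auto
  also have "\<dots> \<le> card ({..K * card I} \<times> {..K * card I})" by (intro card_image_le) simp
  finally show ?thesis by (simp add: power2_eq_square)
qed

text \<open>Here all applications are independent and uniform, unlike those of a student with a strict
  preference list.\<close>

definition filling_prob :: "nat \<Rightarrow> nat \<Rightarrow> nat \<Rightarrow> (nat \<Rightarrow> nat) \<Rightarrow> real" where
  "filling_prob n q K r =
     card (filling_words {..<n} (\<lambda>_. q) (applications {..<n * q} K r)
       (card (accepted_applications {..<n * q} K r))) / n ^ card (applications {..<n * q} K r)"

lemma filling_prob_nonneg: "0 \<le> filling_prob n q K r"
  by (simp add: filling_prob_def)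

lemma filling_prob_le_1: "filling_prob n q K r \<le> 1"
  using card_filling_words_le_power[of "applications {..<n * q} K r" "{..<n}" "\<lambda>_. q"]
  by (auto simp: filling_prob_def divide_le_eq simp flip: of_nat_power)

lemma truncation_factor_le:
  fixes n q K m :: nat
  assumes "2 * K \<le> n" and "m \<le> K * (n * q)"
  shows "real n ^ m / real (n - K) ^ m \<le> exp (2 * K\<^sup>2 * q)"
proof (cases "n = 0")
  case False
  then have n: "0 < n" "K < n" using assms(1) by auto
  have "real m \<le> K * (real n * q)" using assms(2) by (simp flip: of_nat_mult)
  then have "m * (K / n) \<le> K * (real n * q) * (K / n)" by (rule mult_right_mono) simp
  then have "exp (- 2 * real (K\<^sup>2 * q)) \<le> (1 - K / n) ^ m"
    using n assms(1)
    by (intro exp_neg_le_one_minus_power) (simp_all add: power2_eq_square field_simps)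
  also have "\<dots> = real (n - K) ^ m / n ^ m"
    using n by (simp add: power_divide[symmetric] of_nat_diff diff_divide_distrib)
  finally show ?thesis using n by (simp add: exp_minus field_simps)
qed (use assms in simp)

lemma rejections_event_prob_le_weight:
  fixes n q K :: nat and r :: "nat \<Rightarrow> nat"
  assumes r: "r \<in> {..<n * q} \<rightarrow> {..K}" and "0 < q" and "0 < K" and "2 * K \<le> n"
  shows "profile_prob n q (rejections_event n q K r)
       \<le> exp (2 * K\<^sup>2 * q) * (K * (n * q) + 1) * filling_prob n q K r
         * trunc_geom_weight {..<n * q} K (acceptance_rate {..<n * q} K r) r"
    (is "?prob \<le> ?E * _ * _ * ?g")
proof -
  define D where "D = applications {..<n * q} K r"
  define A T where "A = card (accepted_applications {..<n * q} K r)" and "T = sum r {..<n * q}"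
  let ?F = "card (filling_words {..<n} (\<lambda>_. q) D A)"
  have card_D: "card D = A + T" using r by (simp add: D_def A_def T_def card_applications)
  have D_le: "card D \<le> K * (n * q)"
    using card_applications_le[of "{..<n * q}" K r] by (simp add: D_def)
  have n: "0 < n" "K < n" using assms(3,4) by auto
  have "0 < n * q" using n assms(2) by simp
  also have "\<dots> \<le> A + T"
    using card_le_card_applications[of "{..<n * q}" K r] assms(3) card_D by (simp add: D_def)
  finally have "0 < A + T" .
  have rate: "acceptance_rate {..<n * q} K r = real A / real (A + T)"
    unfolding acceptance_rate_def D_def[symmetric] card_D A_def by simp
  have "1 / real (card D choose A) \<le> real (A + T + 1) * ?g"
    unfolding card_D trunc_geom_weight_eq_power[OF finite_lessThan] A_def[symmetric] T_def[symmetric]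
    using inverse_binomial_le[OF \<open>0 < A + T\<close> rate] .
  also have "\<dots> \<le> (K * (n * q) + 1) * ?g"
    using D_le acceptance_rate_bounds[of "{..<n * q}" K r] card_D
    by (intro mult_right_mono trunc_geom_weight_nonneg) (auto simp flip: of_nat_add of_nat_mult)
  finally have geometric: "1 / real (card D choose A) \<le> (K * (n * q) + 1) * ?g" .
  have "?prob \<le> ?F / (real (n - K) ^ card D * (card D choose A))"
    using rejections_event_prob_le[of K n q r] n
    by (simp add: pos_le_divide_eq card_D mult.assoc flip: D_def A_def)
  also have "\<dots> = filling_prob n q K r
      * ((real n ^ card D / real (n - K) ^ card D) * (1 / real (card D choose A)))"
    using n by (simp add: filling_prob_def flip: D_def A_def)
  also have "\<dots> \<le> filling_prob n q K r * (?E * ((K * (n * q) + 1) * ?g))"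
    using assms(4) D_le
    by (intro mult_left_mono mult_mono truncation_factor_le geometric)
      (auto simp: filling_prob_nonneg)
  finally show ?thesis by (simp add: mult_ac)
qed

lemma rejection_vectors_prob_le:
  fixes n q K :: nat and y z :: real
  assumes "0 < q" and "0 < K" and "2 * K \<le> n" and R: "R \<subseteq> {..<n * q} \<rightarrow>\<^sub>E {..K}"
    and "0 \<le> y" and words: "\<And>r. r \<in> R \<Longrightarrow> filling_prob n q K r \<le> y"
    and "0 \<le> z" and weights: "\<And>p. p \<in> acceptance_rate {..<n * q} K ` R \<Longrightarrow>
      sum (trunc_geom_weight {..<n * q} K p) R \<le> z"
  shows "profile_prob n q {(P, Q). restrict (capped_DA n q K P Q) {..<n * q} \<in> R}
       \<le> exp (2 * K\<^sup>2 * q) * (K * (n * q) + 1) ^ 3 * (y * z)"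
proof -
  let ?rate = "acceptance_rate {..<n * q} K" and ?g = "trunc_geom_weight {..<n * q} K"
  let ?C = "exp (2 * K\<^sup>2 * q) * (K * (n * q) + 1)"
  have finR: "finite R" by (rule finite_subset[OF R]) (intro finite_PiE, auto)
  have g_nonneg: "0 \<le> ?g p r" if "p \<in> ?rate ` R" for p r
    using that acceptance_rate_bounds[of "{..<n * q}"] by (auto intro: trunc_geom_weight_nonneg)
  have "profile_prob n q {(P, Q). restrict (capped_DA n q K P Q) {..<n * q} \<in> R}
      \<le> profile_prob n q (\<Union>r\<in>R. rejections_event n q K r)"
  proof (rule profile_prob_mono)
    fix P Q assume "(P, Q) \<in> {(P, Q). restrict (capped_DA n q K P Q) {..<n * q} \<in> R}"
    moreover have "(P, Q) \<in> rejections_event n q K (restrict (capped_DA n q K P Q) {..<n * q})"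
      by (simp add: rejections_event_def)
    ultimately show "(P, Q) \<in> (\<Union>r\<in>R. rejections_event n q K r)" by blast
  qed
  also have "\<dots> \<le> (\<Sum>r\<in>R. profile_prob n q (rejections_event n q K r))"
    using finR by (intro measure_pmf.finite_measure_subadditive_finite) auto
  also have "\<dots> \<le> (\<Sum>r\<in>R. ?C * filling_prob n q K r * ?g (?rate r) r)"
    using R assms(1-3) by (intro sum_mono rejections_event_prob_le_weight) auto
  also have "\<dots> \<le> (\<Sum>r\<in>R. ?C * y * ?g (?rate r) r)"
    using words g_nonneg by (intro sum_mono mult_right_mono mult_left_mono) auto
  also have "\<dots> = ?C * y * (\<Sum>r\<in>R. ?g (?rate r) r)" by (simp only: sum_distrib_left)
  also have "\<dots> \<le> ?C * y * ((K * (n * q) + 1)\<^sup>2 * z)"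
  proof (rule mult_left_mono)
    have "(\<Sum>r\<in>R. ?g (?rate r) r) \<le> card (?rate ` R) * z"
      using finR g_nonneg weights by (intro sum_diagonal_le_card_image_mult) auto
    also have "\<dots> \<le> (K * (n * q) + 1)\<^sup>2 * z"
      using card_acceptance_rates_le[of "{..<n * q}" K R] \<open>0 \<le> z\<close>
      by (intro mult_right_mono) (simp_all only: of_nat_le_iff card_lessThan finite_lessThan)
    finally show "(\<Sum>r\<in>R. ?g (?rate r) r) \<le> (K * (n * q) + 1)\<^sup>2 * z" .
  qed (use \<open>0 \<le> y\<close> in simp)
  finally show ?thesis
    by (simp only: power2_eq_square power3_eq_cube of_nat_mult of_nat_power mult_ac)
qed

text \<open>With less than \<open>\<mu> n\<close> applications, few students exhaust their lists, so almost every school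
  receives an application.\<close>

lemma card_missed_le_if_few_applications:
  fixes n q K :: nat and r :: "nat \<Rightarrow> nat" and \<beta> \<mu> :: real
  assumes "0 < q" and "0 < K" and "\<mu> \<le> \<beta> * K" and r: "r \<in> {..<n * q} \<rightarrow> {..K}"
  defines "D \<equiv> applications {..<n * q} K r" and "B \<equiv> accepted_applications {..<n * q} K r"
  assumes few: "card D < \<mu> * n" and x: "x \<in> filling_words {..<n} (\<lambda>_. q) D (card B)"
  shows "card ({..<n} - x ` D) \<le> \<beta> * n"
proof -
  have "card B + card ({..<n} - x ` D) \<le> n * q"
    using card_missed_le_unfilled[OF _ _ x] assms(1) by simp
  then have "K * (card B + card ({..<n} - x ` D)) \<le> K * (n * q)" by (rule mult_le_mono2)
  also have "\<dots> \<le> K * card B + sum r {..<n * q}" using cap_times_card_le[OF _ r] by (simp add: B_def)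
  finally have "K * card ({..<n} - x ` D) \<le> card D"
    using card_applications[OF _ r] by (simp add: D_def distrib_left)
  then have "real (K * card ({..<n} - x ` D)) \<le> \<mu> * n" using few by linarith
  also have "\<dots> \<le> K * (\<beta> * n)" using mult_right_mono[OF assms(3), of n] by (simp add: mult_ac)
  finally show ?thesis using assms(2) by simp
qed

lemma filling_prob_le_if_few_applications:
  fixes n q K :: nat and r :: "nat \<Rightarrow> nat" and \<beta> \<mu> :: real
  assumes "0 < q" and "2 \<le> n" and "0 < K" and "\<mu> \<le> \<beta> * K" and r: "r \<in> {..<n * q} \<rightarrow> {..K}"
    and few: "card (applications {..<n * q} K r) < \<mu> * n"
  shows "filling_prob n q K r \<le> (2 powr \<beta> * (1 - exp (- 2 * \<mu>) / 2)) ^ n"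
proof -
  define D where "D = applications {..<n * q} K r"
  let ?F = "filling_words {..<n} (\<lambda>_. q) D (card (accepted_applications {..<n * q} K r))"
  let ?few_missed = "{x \<in> D \<rightarrow>\<^sub>E {..<n}. card ({..<n} - x ` D) \<le> \<beta> * n}"
  have "finite D" by (simp add: D_def)
  have "?F \<subseteq> ?few_missed"
    using card_missed_le_if_few_applications[OF assms(1,3,4) r few, folded D_def]
    by (auto simp: filling_words_def)
  moreover have "finite ?few_missed"
    using \<open>finite D\<close> by (intro finite_subset[OF _ finite_PiE[of D "\<lambda>_. {..<n}"]]) auto
  ultimately have "real (card ?F) \<le> card ?few_missed" by (intro of_nat_mono card_mono)
  also have "\<dots> \<le> real n ^ card D * (2 powr \<beta> * (1 - (1 - 1 / n) ^ card D / 2)) ^ n"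
    using card_few_missed_le[OF \<open>finite D\<close>, of "{..<n}" \<beta>] assms(2)
    by (simp add: lessThan_empty_iff)
  also have "\<dots> \<le> real n ^ card D * (2 powr \<beta> * (1 - exp (- 2 * \<mu>) / 2)) ^ n"
  proof -
    have "exp (- 2 * \<mu>) \<le> (1 - 1 / n) ^ card D"
      using few assms(2) by (intro exp_neg_le_one_minus_power) (auto simp: D_def field_simps)
    moreover have "(1 - 1 / n) ^ card D \<le> (1 :: real)" using assms(2) by (intro power_le_one) auto
    ultimately show ?thesis by (intro mult_left_mono power_mono) auto
  qed
  finally show ?thesis
    using assms(2) by (simp add: filling_prob_def divide_le_eq mult.commute flip: D_def)
qed

definition few_applications_event ::
  "nat \<Rightarrow> nat \<Rightarrow> nat \<Rightarrow> real \<Rightarrow> profile set" where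
  "few_applications_event n q K m =
     {(P, Q). real (card (applications {..<n * q} K (capped_DA n q K P Q))) < m}"

definition low_rank_event ::
  "nat \<Rightarrow> nat \<Rightarrow> nat \<Rightarrow> nat \<Rightarrow> real \<Rightarrow> profile set" where
  "low_rank_event n q K k m =
     {(P, Q). m \<le> real (card {i \<in> {..<n * q}. capped_DA n q K P Q i < k})}"

lemma few_applications_prob_le:
  fixes n q K :: nat and \<beta> \<mu> :: real
  assumes "0 < q" and "2 \<le> n" and "0 < K" and "2 * K \<le> n" and "0 \<le> \<mu>" and "\<mu> \<le> \<beta> * K"
  shows "profile_prob n q (few_applications_event n q K (\<mu> * n))
       \<le> exp (2 * K\<^sup>2 * q) * (K * (n * q) + 1) ^ 3 * (2 powr \<beta> * (1 - exp (- 2 * \<mu>) / 2)) ^ n"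
proof -
  let ?I = "{..<n * q}"
  let ?R = "{r \<in> ?I \<rightarrow>\<^sub>E {..K}. card (applications ?I K r) < \<mu> * n}"
  let ?y = "(2 powr \<beta> * (1 - exp (- 2 * \<mu>) / 2)) ^ n"
  have weights: "sum (trunc_geom_weight ?I K p) ?R \<le> 1" if "p \<in> acceptance_rate ?I K ` ?R" for p
    using that acceptance_rate_bounds[of ?I K] by (intro sum_trunc_geom_weight_le_1) auto
  have "exp (- 2 * \<mu>) \<le> 1" using assms(5) by simp
  then have "0 \<le> 1 - exp (- 2 * \<mu>) / 2" by linarith
  then have "0 \<le> ?y" by simp
  have "profile_prob n q (few_applications_event n q K (\<mu> * n))
      \<le> profile_prob n q {(P, Q). restrict (capped_DA n q K P Q) ?I \<in> ?R}"
    by (intro profile_prob_mono) (auto simp: few_applications_event_def school_choice.final_le)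
  also have "\<dots> \<le> exp (2 * K\<^sup>2 * q) * (K * (n * q) + 1) ^ 3 * (?y * 1)"
    using assms weights \<open>0 \<le> ?y\<close>
    by (intro rejection_vectors_prob_le filling_prob_le_if_few_applications) auto
  finally show ?thesis by simp
qed

lemma acceptance_rate_le_if_many_applications:
  fixes n q K :: nat and \<mu> :: real
  assumes "0 < n" and "0 < \<mu>" and many: "\<mu> * n \<le> card (applications {..<n * q} K r)"
  shows "acceptance_rate {..<n * q} K r \<le> q / \<mu>"
proof -
  have "card (accepted_applications {..<n * q} K r) \<le> n * q"
    using card_mono[of "{..<n * q}" "{i \<in> {..<n * q}. r i < K}"]
    by (auto simp: card_accepted_applications)
  then have "acceptance_rate {..<n * q} K r \<le> (n * q) / (\<mu> * n)"
    unfolding acceptance_rate_def using assms by (intro frac_le) (auto simp flip: of_nat_mult)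
  then show ?thesis using assms(1) by simp
qed

lemma low_rank_many_applications_prob_le:
  fixes n q k K :: nat and \<delta> \<mu> :: real
  assumes "0 < q" and "2 * K \<le> n" and "0 < k" and "k \<le> K" and "k * q \<le> \<mu>"
  shows "profile_prob n q
           (low_rank_event n q K k (\<delta> * (n * q)) - few_applications_event n q K (\<mu> * n))
       \<le> exp (2 * K\<^sup>2 * q) * (K * (n * q) + 1) ^ 3 * (2 ^ q * (k * q / \<mu>) powr (\<delta> * q)) ^ n"
    (is "profile_prob n q ?event \<le> _ * ?z")
proof -
  let ?I = "{..<n * q}"
  let ?R = "{r \<in> ?I \<rightarrow>\<^sub>E {..K}. \<mu> * n \<le> card (applications ?I K r) \<and>
    \<delta> * (n * q) \<le> card {i \<in> ?I. r i < k}}"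
  have "0 < n" "0 < \<mu>" using assms by (auto intro: less_le_trans[of 0 "real (k * q)"])
  have weights: "sum (trunc_geom_weight ?I K p) ?R \<le> ?z"
    if p_rate: "p \<in> acceptance_rate ?I K ` ?R" for p
  proof -
    have p: "0 \<le> p" "p \<le> 1" "p \<le> q / \<mu>"
      using p_rate acceptance_rate_bounds[of ?I K]
        acceptance_rate_le_if_many_applications[OF \<open>0 < n\<close> \<open>0 < \<mu>\<close>] by auto
    then have "k * p \<le> k * q / \<mu>" using mult_left_mono[of p "q / \<mu>" k] by simp
    then have "sum (trunc_geom_weight ?I K p) ?R
        \<le> 2 ^ card ?I * (k * q / \<mu>) powr (\<delta> * (n * q))"
      using p assms \<open>0 < \<mu>\<close> by (intro sum_trunc_geom_weight_many_low_le) auto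
    also have "\<dots> = ?z"
      using assms \<open>0 < \<mu>\<close>
      by (simp add: power_mult_distrib powr_realpow[symmetric] powr_powr mult_ac flip: power_mult)
    finally show ?thesis .
  qed
  have "profile_prob n q ?event
      \<le> profile_prob n q {(P, Q). restrict (capped_DA n q K P Q) ?I \<in> ?R}"
    by (intro profile_prob_mono) (auto simp: few_applications_event_def low_rank_event_def
        school_choice.final_le cong: conj_cong)
  also have "\<dots> \<le> exp (2 * K\<^sup>2 * q) * (K * (n * q) + 1) ^ 3 * (1 * ?z)"
    using assms weights filling_prob_le_1 by (intro rejection_vectors_prob_le) auto
  finally show ?thesis by simp
qed

lemma low_rank_prob_le:
  fixes n q k K :: nat and \<beta> \<delta> \<mu> :: real
  assumes "0 < q" and "2 \<le> n" and "2 * K \<le> n" and "0 < k" and "k \<le> K"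
    and "k * q \<le> \<mu>" and "\<mu> \<le> \<beta> * K"
  shows "profile_prob n q (low_rank_event n q K k (\<delta> * (n * q)))
       \<le> exp (2 * K\<^sup>2 * q) * (K * (n * q) + 1) ^ 3
         * ((2 powr \<beta> * (1 - exp (- 2 * \<mu>) / 2)) ^ n + (2 ^ q * (k * q / \<mu>) powr (\<delta> * q)) ^ n)"
    (is "_ \<le> ?C * _")
proof -
  let ?few = "few_applications_event n q K (\<mu> * n)"
  let ?low = "low_rank_event n q K k (\<delta> * (n * q))"
  have "0 \<le> \<mu>" using assms(6) by (rule order.trans[rotated]) simp
  have "profile_prob n q ?low \<le> profile_prob n q (?few \<union> (?low - ?few))"
    by (intro measure_pmf.finite_measure_mono) auto
  also have "\<dots> \<le> profile_prob n q ?few + profile_prob n q (?low - ?few)"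
    by (intro measure_Un_le) auto
  also have "\<dots> \<le> ?C * (2 powr \<beta> * (1 - exp (- 2 * \<mu>) / 2)) ^ n
      + ?C * (2 ^ q * (k * q / \<mu>) powr (\<delta> * q)) ^ n"
    using assms \<open>0 \<le> \<mu>\<close>
    by (intro add_mono few_applications_prob_le low_rank_many_applications_prob_le) auto
  finally show ?thesis by (simp only: distrib_left)
qed

lemma ex_powr_exponent_less_1:
  fixes x :: real
  assumes "0 < x" and "x < 1"
  obtains \<beta> where "0 < \<beta>" and "2 powr \<beta> * x < 1"
proof
  show "0 < - log 2 x / 2" using assms by simp
  have "2 powr (- log 2 x / 2) * x = 2 powr (- log 2 x / 2 + log 2 x)"
    using assms(1) by (simp only: powr_add) simp
  also have "\<dots> < 1" using assms by (simp add: powr_less_one)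
  finally show "2 powr (- log 2 x / 2) * x < 1" .
qed

lemma low_rank_prob_tendsto_0:
  fixes q k :: nat and \<delta> :: real
  assumes "0 < q" and "0 < k" and "0 < \<delta>"
  obtains K where "(\<lambda>n. profile_prob n q (low_rank_event n q K k (\<delta> * (n * q)))) \<longlonglongrightarrow> 0"
proof -
  define c :: real where "c = ((1 / 2) ^ (q + 1)) powr (1 / (\<delta> * q))"
  define \<mu> where "\<mu> = k * q / c"
  define x where "x = 1 - exp (- 2 * \<mu>) / 2"
  have "0 < c" by (simp add: c_def)
  have "c \<le> 1"
    unfolding c_def using assms(3) power_le_one[of "1 / 2 :: real" "q + 1"] by (intro powr_le1) auto
  have c: "2 ^ q * c powr (\<delta> * q) = 1 / 2"
    using assms by (simp add: c_def powr_powr power_one_over)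
  have \<mu>: "0 < \<mu>" "k * q \<le> \<mu>" "k * q / \<mu> = c"
    using \<open>0 < c\<close> \<open>c \<le> 1\<close> assms by (auto simp: \<mu>_def le_divide_eq mult_left_le)
  have x: "0 < x" "x < 1" using \<mu>(1) by (auto simp: x_def intro: less_trans[of _ 1])
  obtain \<beta> where \<beta>: "0 < \<beta>" "2 powr \<beta> * x < 1" using ex_powr_exponent_less_1[OF x] .
  define K where "K = max k (nat \<lceil>\<mu> / \<beta>\<rceil>)"
  have "\<mu> / \<beta> \<le> K" unfolding K_def by linarith
  then have K: "k \<le> K" "\<mu> \<le> \<beta> * K"
    using \<beta>(1) by (auto simp: K_def divide_le_eq mult.commute)
  define y where "y = 2 powr \<beta> * x"
  define C where "C = exp (real (2 * K\<^sup>2 * q))"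
  define d where "d = real (K * q)"
  have "0 < C" "0 < d" "0 < y" "y < 1" using assms K x \<beta> by (simp_all add: C_def d_def y_def)
  have "(\<lambda>n. C * (d * real n + 1) ^ 3 * z ^ n) \<longlonglongrightarrow> 0" if "0 < z" "z < 1" for z
    using that \<open>0 < C\<close> \<open>0 < d\<close> by real_asymp
  from tendsto_add[OF this[of y] this[of "1 / 2"]]
  have lim: "(\<lambda>n. C * (d * real n + 1) ^ 3 * (y ^ n + (1 / 2) ^ n)) \<longlonglongrightarrow> 0"
    using \<open>0 < y\<close> \<open>y < 1\<close> by (simp add: distrib_left)
  let ?prob = "\<lambda>n. profile_prob n q (low_rank_event n q K k (\<delta> * (n * q)))"
  have "norm (?prob n) \<le> C * (d * real n + 1) ^ 3 * (y ^ n + (1 / 2) ^ n)"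
    if "max 2 (2 * K) \<le> n" for n
    using low_rank_prob_le[of q n K k \<mu> \<beta> \<delta>, unfolded \<mu>(3) c] that assms K \<mu>(2)
    by (simp add: C_def x_def y_def d_def mult_ac add_ac)
  then have "\<forall>\<^sub>F n in sequentially.
      norm (?prob n) \<le> C * (d * real n + 1) ^ 3 * (y ^ n + (1 / 2) ^ n)"
    by (rule eventually_sequentiallyI)
  then show thesis by (rule that[OF Lim_null_comparison[OF _ lim]])
qed

section \<open>Choices avoiding a large set of schools\<close>

lemma card_avoiding_permutations_le:
  assumes "k \<le> n" and "0 < n" and T: "T \<subseteq> {..<n}"
  shows "card {p. p permutes {..<n} \<and> p ` {..<k} \<subseteq> {..<n} - T} \<le> fact n * (1 - card T / n) ^ k"
proof -
  let ?avoid = "{p. p permutes {..<n} \<and> p ` {..<k} \<subseteq> {..<n} - T}"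
  have "card ?avoid * n ^ k \<le> fact n * card ({..<n} - T) ^ k"
    using card_permutations_image_subset_le[of "{..<n}" "{..<k}" "{..<n} - T"] assms(1) by auto
  then have "real (card ?avoid * n ^ k) \<le> real (fact n * card ({..<n} - T) ^ k)"
    by (rule of_nat_mono)
  moreover have "real (card ({..<n} - T)) = n * (1 - card T / n)"
    using T card_mono[OF _ T] assms(2)
    by (simp add: card_Diff_subset finite_subset of_nat_diff field_simps)
  ultimately show ?thesis
    using assms(2) by (simp add: power_mult_distrib mult_ac mult_le_cancel_left)
qed

lemma first_choices_avoid_prob_le:
  assumes "k \<le> n" and "0 < n" and B: "B \<subseteq> {..<n * q}" and T: "T \<subseteq> {..<n}"
  shows "profile_prob n q {(P, Q). \<forall>i\<in>B. \<forall>j<k. P i j \<notin> T} \<le> (1 - card T / n) ^ (k * card B)"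
proof -
  let ?N = "n * q" and ?perms = "{p. p permutes {..<n}}" and ?\<theta> = "1 - card T / n"
  let ?event = "{(P, Q). \<forall>i\<in>B. \<forall>j<k. P i j \<notin> T}"
  let ?avoid = "{p. p permutes {..<n} \<and> p ` {..<k} \<subseteq> {..<n} - T}"
  let ?prefs = "PiE {..<?N} (\<lambda>i. if i \<in> B then ?avoid else ?perms)"
  let ?prios = "PiE {..<n} (\<lambda>_. {p. p permutes {..<?N}})"
  have fin: "finite ?avoid" "finite ?perms" "finite {p. p permutes {..<?N}}"
    using finite_permutations[of "{..<n}"] finite_permutations[of "{..<?N}"]
    by (auto intro: finite_subset[of _ ?perms])
  have "profiles n q \<inter> ?event \<subseteq> ?prefs \<times> ?prios"
  proof (rule subrelI)
    fix P Q assume PQ: "(P, Q) \<in> profiles n q \<inter> ?event"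
    then have "P i ` {..<k} \<subseteq> {..<n} - T" if "i \<in> B" for i
      using that B assms(1) profiles_choice_less[of P Q n q i] by auto
    with PQ show "(P, Q) \<in> ?prefs \<times> ?prios" by (auto simp: profiles_def PiE_iff)
  qed
  then have "card (profiles n q \<inter> ?event) \<le> card (?prefs \<times> ?prios)"
    using fin by (intro card_mono finite_cartesian_product finite_PiE) auto
  also have "\<dots> = (\<Prod>i<?N. card (if i \<in> B then ?avoid else ?perms)) * fact ?N ^ n"
    by (simp add: card_cartesian_product card_PiE card_permutations)
  finally have "real (card (profiles n q \<inter> ?event))
      \<le> real ((\<Prod>i<?N. card (if i \<in> B then ?avoid else ?perms)) * fact ?N ^ n)"
    by (rule of_nat_mono)
  also have "\<dots> = (\<Prod>i<?N. real (card (if i \<in> B then ?avoid else ?perms))) * fact ?N ^ n"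
    by (simp only: of_nat_mult of_nat_prod of_nat_power of_nat_fact)
  also have "\<dots> \<le> (\<Prod>i<?N. fact n * (if i \<in> B then ?\<theta> ^ k else 1)) * fact ?N ^ n"
    using card_avoiding_permutations_le[OF assms(1,2) T]
    by (intro mult_right_mono prod_mono) (auto simp: card_permutations)
  also have "\<dots> = card (profiles n q) * ?\<theta> ^ (k * card B)"
    using B by (simp add: card_profiles prod.distrib prod.If_cases Int_absorb1 power_mult)
  finally show ?thesis by (simp add: measure_pmf_of_set divide_le_eq card_gt_0_iff mult.commute)
qed

definition avoiding_event ::
  "nat \<Rightarrow> nat \<Rightarrow> nat \<Rightarrow> real \<Rightarrow> real \<Rightarrow> profile set" where
  "avoiding_event n q k b t = {(P, Q). \<exists>B T. B \<subseteq> {..<n * q} \<and> T \<subseteq> {..<n} \<and>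
     b \<le> real (card B) \<and> t \<le> real (card T) \<and> (\<forall>i\<in>B. \<forall>j<k. P i j \<notin> T)}"

lemma avoiding_event_prob_le:
  fixes b \<tau> :: real
  assumes "k \<le> n" and "0 < n" and "0 < \<tau>" and "\<tau> < 1"
  shows "profile_prob n q (avoiding_event n q k b (\<tau> * n)) \<le> 2 ^ (n * q + n) * (1 - \<tau>) powr (k * b)"
proof -
  let ?Z = "{(B, T) \<in> Pow {..<n * q} \<times> Pow {..<n}. b \<le> card B \<and> \<tau> * n \<le> card T}"
  let ?F = "\<lambda>(B, T). {(P, Q). \<forall>i\<in>B. \<forall>j<k. P i j \<notin> T} :: profile set"
  have finZ: "finite ?Z" by (rule finite_subset[of _ "Pow {..<n * q} \<times> Pow {..<n}"]) auto
  have "avoiding_event n q k b (\<tau> * n) \<subseteq> (\<Union>u\<in>?Z. ?F u)"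
    unfolding avoiding_event_def by blast
  then have "profile_prob n q (avoiding_event n q k b (\<tau> * n)) \<le> profile_prob n q (\<Union>u\<in>?Z. ?F u)"
    by (intro measure_pmf.finite_measure_mono) auto
  also have "\<dots> \<le> (\<Sum>u\<in>?Z. profile_prob n q (?F u))"
    using finZ by (intro measure_pmf.finite_measure_subadditive_finite) auto
  also have "\<dots> \<le> (\<Sum>u\<in>?Z. (1 - \<tau>) powr (k * b))"
  proof (rule sum_mono)
    fix u assume "u \<in> ?Z"
    then obtain B T where u: "u = (B, T)" and B: "B \<subseteq> {..<n * q}" "b \<le> card B"
      and T: "T \<subseteq> {..<n}" "\<tau> * n \<le> card T" by auto
    have "card T \<le> n" using card_mono[OF _ T(1)] by simp
    have "profile_prob n q (?F u) \<le> (1 - card T / n) ^ (k * card B)"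
      using first_choices_avoid_prob_le[OF assms(1,2) B(1) T(1)] by (simp add: u)
    also have "\<dots> \<le> (1 - \<tau>) ^ (k * card B)"
      using T(2) \<open>card T \<le> n\<close> assms(2) by (intro power_mono) (simp_all add: field_simps)
    also have "\<dots> = (1 - \<tau>) powr (k * real (card B))"
      using assms(4) by (simp flip: powr_realpow)
    also have "\<dots> \<le> (1 - \<tau>) powr (k * b)"
      using B(2) assms(3,4) by (intro powr_mono' mult_left_mono) auto
    finally show "profile_prob n q (?F u) \<le> (1 - \<tau>) powr (k * b)" .
  qed
  also have "\<dots> = card ?Z * (1 - \<tau>) powr (k * b)" by simp
  also have "\<dots> \<le> 2 ^ (n * q + n) * (1 - \<tau>) powr (k * b)"
  proof (rule mult_right_mono)
    have "card ?Z \<le> card (Pow {..<n * q} \<times> Pow {..<n})" by (intro card_mono) auto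
    also have "\<dots> = 2 ^ (n * q + n)" by (simp add: card_cartesian_product card_Pow power_add)
    finally show "real (card ?Z) \<le> 2 ^ (n * q + n)" by (simp flip: of_nat_le_iff)
  qed simp
  finally show ?thesis .
qed

lemma avoiding_event_prob_tendsto_0:
  fixes b \<tau> :: real
  assumes "0 < q" and "0 < b" and "0 < \<tau>" and "\<tau> < 1"
  obtains k where "0 < k"
    and "(\<lambda>n. profile_prob n q (avoiding_event n q k (b * (n * q)) (\<tau> * n))) \<longlonglongrightarrow> 0"
proof -
  define x where "x = (1 - \<tau>) powr (b * q)"
  have x: "0 < x" "x < 1"
    using assms powr_less_mono'[of "1 - \<tau>" 0 "b * q"] by (auto simp: x_def)
  obtain k where k: "x ^ k < (1 / 2) ^ (q + 2)"
    using real_arch_pow_inv[OF _ x(2), of "(1 / 2) ^ (q + 2)"] by auto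
  moreover have "(1 / 2 :: real) ^ (q + 2) \<le> 1" by (intro power_le_one) auto
  ultimately have "k \<noteq> 0" by (intro notI) simp
  let ?prob = "\<lambda>n. profile_prob n q (avoiding_event n q k (b * (n * q)) (\<tau> * n))"
  have "norm (?prob n) \<le> (1 / 2) ^ n" if "k \<le> n" for n
  proof -
    have "?prob n \<le> 2 ^ (n * q + n) * (1 - \<tau>) powr (k * (b * (n * q)))"
      using that assms(3,4) \<open>k \<noteq> 0\<close> by (intro avoiding_event_prob_le) auto
    also have "\<dots> = (2 ^ (q + 1) * x ^ k) ^ n"
      using assms(4)
      by (simp add: x_def power_mult_distrib powr_powr mult_ac powr_realpow[symmetric] power_add
          flip: power_mult)
    also have "\<dots> \<le> (1 / 2) ^ n"
      using k x(1) by (intro power_mono) (auto simp: power_one_over field_simps)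
    finally show ?thesis by simp
  qed
  then have "\<forall>\<^sub>F n in sequentially. norm (?prob n) \<le> (1 / 2) ^ n"
    by (rule eventually_sequentiallyI)
  then have "?prob \<longlonglongrightarrow> 0"
    by (rule Lim_null_comparison) (simp add: LIMSEQ_realpow_zero)
  with \<open>k \<noteq> 0\<close> show thesis by (intro that) auto
qed

section \<open>The envy digraph\<close>

lemma da_final_less:
  assumes PQ: "(P, Q) \<in> profiles n q" and i: "i < n * q"
  shows "da_final n q P Q i < n"
proof (rule ccontr)
  interpret strict_school_choice "{..<n * q}" "\<lambda>_. q" P "\<lambda>s. inv (Q s)" n
    using PQ by (rule profiles_strict_school_choice)
  assume "\<not> ?thesis"
  then have dropout: "final n i = n"
    using final_le[of n i] by (simp add: da_final_eq_capped_DA)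
  have full: "card (holders n (final n) s) = q" if "s < n" for s
  proof -
    have "s \<in> P i ` {..<n}" using permutes_image[OF profiles_permutes(1)[OF PQ i]] that by simp
    then obtain j where "j < n" "s = P i j" by auto
    then show ?thesis using card_rejecter_holders[of n i j] i dropout by simp
  qed
  have "n * q = (\<Sum>s<n. card (holders n (final n) s))" using full by simp
  also have "\<dots> = card (\<Union>s<n. holders n (final n) s)"
    by (intro card_UN_disjoint[symmetric]) (auto simp: holders_def)
  also have "\<dots> \<le> card ({..<n * q} - {i})"
    using dropout by (intro card_mono) (auto simp: holders_def)
  also have "\<dots> < n * q" using i by simp
  finally show False by simp
qed

lemma card_le_quota_times_card_DA_image:
  assumes PQ: "(P, Q) \<in> profiles n q" and "A \<subseteq> {..<n * q}"
  shows "card A \<le> q * card (DA n q P Q ` A)"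
proof -
  interpret strict_school_choice "{..<n * q}" "\<lambda>_. q" P "\<lambda>s. inv (Q s)" n
    using PQ by (rule profiles_strict_school_choice)
  have finA: "finite A" using assms(2) finite_subset by blast
  have "A \<subseteq> (\<Union>s\<in>DA n q P Q ` A. holders n (final n) s)"
    using assms(2) da_final_less[OF PQ] by (auto simp: holders_def DA_def da_final_eq_capped_DA)
  then have "card A \<le> card (\<Union>s\<in>DA n q P Q ` A. holders n (final n) s)"
    using finA by (intro card_mono) auto
  also have "\<dots> \<le> (\<Sum>s\<in>DA n q P Q ` A. card (holders n (final n) s))"
    using finA by (intro card_UN_le) simp
  also have "\<dots> \<le> card (DA n q P Q ` A) * q"
    using sum_bounded_above[of "DA n q P Q ` A" "\<lambda>s. card (holders n (final n) s)" q]
    by (simp add: card_holders_final_le)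
  finally show ?thesis by (simp add: mult.commute)
qed

lemma out_closed_envy_choice_neq:
  assumes PQ: "(P, Q) \<in> profiles n q" and closed: "out_closed {..<n * q} (envy_edges n q P Q) A"
    and "i \<in> A" and "l \<in> {..<n * q} - A" and "j < da_final n q P Q i"
  shows "P i j \<noteq> DA n q P Q l"
proof
  assume "P i j = DA n q P Q l"
  have "i < n * q" using closed \<open>i \<in> A\<close> by (auto simp: out_closed_def)
  then have rank: "inv (P i) (P i m) = m" for m
    using permutes_inverses(2)[OF profiles_permutes(1)[OF PQ]] by simp
  have "inv (P i) (DA n q P Q l) < inv (P i) (DA n q P Q i)"
    using rank[of j] rank[of "da_final n q P Q i"] assms(5) \<open>P i j = DA n q P Q l\<close>
    by (simp add: DA_def)
  then have "(i, l) \<in> envy_edges n q P Q"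
    using \<open>i < n * q\<close> assms(4) by (simp add: envy_edges_def)
  then show False using closed assms(3,4) by (auto simp: out_closed_def)
qed

lemma avoiding_event_if_balanced_out_closed:
  fixes n q k K :: nat and b low t :: real
  assumes PQ: "(P, Q) \<in> profiles n q" and "K \<le> n" and "0 < q"
    and closed: "out_closed {..<n * q} (envy_edges n q P Q) A"
    and not_low: "(P, Q) \<notin> low_rank_event n q K k low"
    and card_A: "b + low \<le> card A" "card A \<le> n * q - t * q"
  shows "(P, Q) \<in> avoiding_event n q k b t"
proof -
  interpret strict_school_choice "{..<n * q}" "\<lambda>_. q" P "\<lambda>s. inv (Q s)" n
    using PQ by (rule profiles_strict_school_choice)
  let ?I = "{..<n * q}"
  let ?B = "{i \<in> A. k \<le> final K i}" and ?T = "DA n q P Q ` (?I - A)"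
  have A: "A \<subseteq> ?I" "finite A" using closed finite_subset by (auto simp: out_closed_def)
  then have "card A \<le> card ?B + card {i \<in> ?I. final K i < k}"
    using card_mono[of "?B \<union> {i \<in> ?I. final K i < k}" A]
      card_Un_le[of ?B "{i \<in> ?I. final K i < k}"] by fastforce
  then have "b \<le> card ?B" using not_low card_A(1) by (simp add: low_rank_event_def)
  moreover have "t \<le> card ?T"
  proof -
    have "card (?I - A) + card A = n * q"
      using A card_mono[of ?I A] by (simp add: card_Diff_subset)
    moreover have "card (?I - A) \<le> q * card ?T"
      by (intro card_le_quota_times_card_DA_image[OF PQ]) auto
    ultimately have "real (n * q) \<le> real (q * card ?T + card A)" by (intro of_nat_mono) simp
    then have "q * t \<le> q * card ?T" using card_A(2) by (simp add: mult.commute)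
    then show ?thesis using \<open>0 < q\<close> by simp
  qed
  moreover have "P i j \<notin> ?T" if "i \<in> ?B" "j < k" for i j
  proof -
    have "j < final K i" using that by simp
    also have "\<dots> \<le> da_final n q P Q i"
      unfolding da_final_eq_capped_DA using \<open>K \<le> n\<close> by (intro final_mono) auto
    finally show ?thesis using out_closed_envy_choice_neq[OF PQ closed] that(1) by blast
  qed
  moreover have "?T \<subseteq> {..<n}"
    using da_final_less[OF PQ] profiles_choice_less[OF PQ] by (auto simp: DA_def)
  moreover have "?B \<subseteq> ?I" using A(1) by blast
  ultimately show ?thesis unfolding avoiding_event_def by blast
qed

lemma large_scc_if_not_avoiding:
  fixes n q k K :: nat and \<epsilon> :: real
  assumes PQ: "(P, Q) \<in> profiles n q" and "0 < q" and "0 < n" and "K \<le> n" and \<epsilon>: "0 < \<epsilon>" "\<epsilon> \<le> 1"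
    and not_low: "(P, Q) \<notin> low_rank_event n q K k (\<epsilon> / 4 * (n * q))"
    and not_avoiding: "(P, Q) \<notin> avoiding_event n q k (\<epsilon> / 4 * (n * q)) (\<epsilon> / 2 * n)"
  obtains C where "is_scc {..<n * q} (envy_edges n q P Q) C" and "(1 - \<epsilon>) * n * q \<le> card C"
proof -
  let ?I = "{..<n * q}" and ?a = "\<epsilon> / 2 * (n * q)"
  have "card ?I - ?a < card A" if "out_closed ?I (envy_edges n q P Q) A" "?a \<le> card A" for A
    using avoiding_event_if_balanced_out_closed[OF PQ \<open>K \<le> n\<close> \<open>0 < q\<close> that(1) not_low,
        of "\<epsilon> / 4 * (n * q)" "\<epsilon> / 2 * n"] not_avoiding that(2)
    by (cases "card ?I - ?a < card A") (auto simp: mult_ac)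
  moreover have "0 < ?a" "?a \<le> card ?I"
    using \<epsilon> \<open>0 < q\<close> \<open>0 < n\<close> mult_right_mono[of "\<epsilon> / 2" 1 "n * q"] by simp_all
  ultimately obtain C where C: "is_scc ?I (envy_edges n q P Q) C" "card ?I - 2 * ?a \<le> card C"
    using large_scc_if_no_balanced_out_closed[OF finite_lessThan] by blast
  then have "(1 - \<epsilon>) * n * q \<le> card C" by (simp add: algebra_simps)
  with C(1) show thesis by (rule that)
qed

definition large_scc_event ::
  "nat \<Rightarrow> nat \<Rightarrow> real \<Rightarrow> profile set" where
  "large_scc_event n q \<epsilon> =
     {(P, Q). \<exists>C. is_scc {..<n * q} (envy_edges n q P Q) C \<and>
        (1 - \<epsilon>) * real n * real q \<le> real (card C)}"

lemma large_scc_event_mono: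
  assumes "\<delta> \<le> \<epsilon>"
  shows "large_scc_event n q \<delta> \<subseteq> large_scc_event n q \<epsilon>"
proof -
  have "(1 - \<epsilon>) * real n * real q \<le> (1 - \<delta>) * real n * real q"
    using assms by (intro mult_right_mono) auto
  then show ?thesis unfolding large_scc_event_def by (auto intro: order.trans)
qed

lemma no_large_scc_prob_le:
  fixes n q k K :: nat and \<epsilon> :: real
  assumes "0 < q" and "max 1 K \<le> n" and "0 < \<epsilon>" and "\<epsilon> \<le> 1"
  shows "1 - profile_prob n q (large_scc_event n q \<epsilon>)
       \<le> profile_prob n q (low_rank_event n q K k (\<epsilon> / 4 * (n * q)))
         + profile_prob n q (avoiding_event n q k (\<epsilon> / 4 * (n * q)) (\<epsilon> / 2 * n))"
    (is "_ \<le> profile_prob n q ?low + profile_prob n q ?avoiding")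
proof -
  have "1 - profile_prob n q (large_scc_event n q \<epsilon>) = profile_prob n q (- large_scc_event n q \<epsilon>)"
    by (simp add: measure_pmf.prob_compl[symmetric] Compl_eq_Diff_UNIV)
  also have "\<dots> \<le> profile_prob n q (?low \<union> ?avoiding)"
  proof (rule profile_prob_mono)
    fix P Q assume PQ: "(P, Q) \<in> profiles n q" "(P, Q) \<in> - large_scc_event n q \<epsilon>"
    show "(P, Q) \<in> ?low \<union> ?avoiding"
    proof (rule ccontr)
      assume "\<not> ?thesis"
      then have "(P, Q) \<notin> ?low" "(P, Q) \<notin> ?avoiding" by auto
      then obtain C where "is_scc {..<n * q} (envy_edges n q P Q) C" "(1 - \<epsilon>) * n * q \<le> card C"
        using large_scc_if_not_avoiding[OF PQ(1), of K \<epsilon> k] assms by auto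
      then show False using PQ(2) by (auto simp: large_scc_event_def)
    qed
  qed
  also have "\<dots> \<le> profile_prob n q ?low + profile_prob n q ?avoiding"
    by (intro measure_Un_le) auto
  finally show ?thesis .
qed

lemma large_scc_prob_tendsto_1:
  fixes q :: nat and \<epsilon> :: real
  assumes "0 < q" and "0 < \<epsilon>" and "\<epsilon> \<le> 1"
  shows "(\<lambda>n. profile_prob n q (large_scc_event n q \<epsilon>)) \<longlonglongrightarrow> 1"
proof -
  obtain k where "0 < k"
    and avoiding: "(\<lambda>n. profile_prob n q (avoiding_event n q k (\<epsilon> / 4 * (n * q)) (\<epsilon> / 2 * n))) \<longlonglongrightarrow> 0"
    using avoiding_event_prob_tendsto_0[of q "\<epsilon> / 4" "\<epsilon> / 2"] assms by auto
  obtain K where low: "(\<lambda>n. profile_prob n q (low_rank_event n q K k (\<epsilon> / 4 * (n * q)))) \<longlonglongrightarrow> 0"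
    using low_rank_prob_tendsto_0[of q k "\<epsilon> / 4"] assms \<open>0 < k\<close> by auto
  let ?bound = "\<lambda>n. profile_prob n q (low_rank_event n q K k (\<epsilon> / 4 * (n * q)))
      + profile_prob n q (avoiding_event n q k (\<epsilon> / 4 * (n * q)) (\<epsilon> / 2 * n))"
  have "norm (profile_prob n q (large_scc_event n q \<epsilon>) - 1) \<le> ?bound n" if "max 1 K \<le> n" for n
    using no_large_scc_prob_le[OF assms(1) that assms(2,3), of k]
      measure_pmf.prob_le_1[of "pmf_of_set (profiles n q)" "large_scc_event n q \<epsilon>"]
    unfolding real_norm_def by linarith
  then have "\<forall>\<^sub>F n in sequentially. norm (profile_prob n q (large_scc_event n q \<epsilon>) - 1) \<le> ?bound n"
    by (rule eventually_sequentiallyI)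
  moreover have "?bound \<longlonglongrightarrow> 0" using tendsto_add[OF low avoiding] by simp
  ultimately have "(\<lambda>n. profile_prob n q (large_scc_event n q \<epsilon>) - 1) \<longlonglongrightarrow> 0"
    by (rule Lim_null_comparison)
  then show ?thesis by (rule LIM_zero_cancel)
qed

theorem mainTheorem11:
  fixes q :: nat and \<epsilon> :: real
  assumes "q > 0" and "\<epsilon> > 0"
  shows "(\<lambda>n. real (card {(P, Q) \<in> profiles n q.
              \<exists>C. is_scc {..<n*q} (envy_edges n q P Q) C \<and>
                  real (card C) \<ge> (1 - \<epsilon>) * real n * real q})
            / real (card (profiles n q))) \<longlonglongrightarrow> 1"
proof -
  define e where "e = min \<epsilon> 1"
  have "(\<lambda>n. profile_prob n q (large_scc_event n q \<epsilon>)) \<longlonglongrightarrow> 1"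
  proof (rule tendsto_sandwich[OF _ _ _ tendsto_const])
    show "(\<lambda>n. profile_prob n q (large_scc_event n q e)) \<longlonglongrightarrow> 1"
      using assms by (intro large_scc_prob_tendsto_1) (auto simp: e_def)
    show "\<forall>\<^sub>F n in sequentially. profile_prob n q (large_scc_event n q e)
        \<le> profile_prob n q (large_scc_event n q \<epsilon>)"
      by (intro always_eventually allI measure_pmf.finite_measure_mono large_scc_event_mono)
        (simp_all add: e_def)
  qed simp_all
  moreover have "profiles n q \<inter> large_scc_event n q \<epsilon> = {(P, Q) \<in> profiles n q.
      \<exists>C. is_scc {..<n * q} (envy_edges n q P Q) C \<and>
        real (card C) \<ge> (1 - \<epsilon>) * real n * real q}" for n
    by (auto simp: large_scc_event_def)
  ultimately show ?thesis by (simp add: measure_pmf_of_set)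
qed

end
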